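(* Let $\mathcal K$ be a quantum channel on $n\times n$ matrices described by Kraus operators $K_1,\dots,K_d\in\mathbb C^{n\times n}$ (with $\mathcal K(\rho)=\sum_j K_j\rho K_j^\dagger$, $\sum_j K_j^\dagger K_j=I_n$) of the form $K_j=s_jP_j$, where $s_j\in\mathbb C$ and each $P_j=P_j^2=P_j^\dagger$ is an orthogonal projector of rank $r$ (the same $r$ for all $j$). Then $\lVert\mathcal K\rVert=\cos^{-1}\left(\sqrt{r/n}\right)$, with $\cos^{-1}$ taking values in $[0,\pi]$.
   Context: For a unitary matrix $U$ of size $m$ with eigenvalues $e^{i\theta_j}$, $\theta_j\in(-\pi,\pi]$, its time-energy cost is $\lVert U\rVert=\max_{1\le j\le m}|\theta_j|$. For a quantum channel $\mathcal K$ acting on an $n$-dimensional system $A$, its time-energy cost is $\lVert\mathcal K\rVert=\inf_U\lVert U\rVert$, where the infimum is over all finite-dimensional ancilla systems $B$ with a fixed standard state $|0\rangle_B$ and all unitaries $U_{BA}$ on $B\otimes A$ such that $\mathcal K(\rho)=\mathrm{Tr}_B[U_{BA}(|0\rangle_B\langle 0|\otimes\rho_A)U_{BA}^\dagger]$ for all density matrices $\rho$ on $A$. *)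

theory Defs
  imports "HOL-Analysis.Analysis" "Jordan_Normal_Form.Matrix" "Jordan_Normal_Form.Char_Poly" "Jordan_Normal_Form.DL_Rank"
begin

definition adj :: "complex mat \<Rightarrow> complex mat" where
  "adj A = mat (dim_col A) (dim_row A) (\<lambda>(i,j). cnj (A $$ (j,i)))"

definition unitary_mat :: "nat \<Rightarrow> complex mat \<Rightarrow> bool" where
  "unitary_mat m U \<longleftrightarrow> U \<in> carrier_mat m m \<and> U * adj U = 1\<^sub>m m \<and> adj U * U = 1\<^sub>m m"

definition tr :: "nat \<Rightarrow> complex mat \<Rightarrow> complex" where
  "tr n A = (\<Sum>i<n. A $$ (i,i))"

definition psd :: "nat \<Rightarrow> complex mat \<Rightarrow> bool" where
  "psd n A \<longleftrightarrow> A \<in> carrier_mat n n \<and>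
     (\<forall>v :: nat \<Rightarrow> complex. let q = (\<Sum>i<n. \<Sum>j<n. cnj (v i) * A $$ (i,j) * v j)
        in Im q = 0 \<and> Re q \<ge> 0)"

definition density :: "nat \<Rightarrow> complex mat \<Rightarrow> bool" where
  "density n \<rho> \<longleftrightarrow> psd n \<rho> \<and> tr n \<rho> = 1"

text \<open>Kronecker product B \<otimes> A of an m x m matrix B (ancilla) and an n x n matrix A
  (system); basis index of b \<otimes> a is b * n + a.\<close>
definition kron :: "nat \<Rightarrow> nat \<Rightarrow> complex mat \<Rightarrow> complex mat \<Rightarrow> complex mat" where
  "kron m n B A = mat (m*n) (m*n) (\<lambda>(i,j). B $$ (i div n, j div n) * A $$ (i mod n, j mod n))"

definition ptrace_B :: "nat \<Rightarrow> nat \<Rightarrow> complex mat \<Rightarrow> complex mat" where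
  "ptrace_B m n M = mat n n (\<lambda>(k,l). \<Sum>b<m. M $$ (b*n + k, b*n + l))"

definition ket0bra0 :: "nat \<Rightarrow> complex mat" where
  "ket0bra0 m = mat m m (\<lambda>(i,j). if i = 0 \<and> j = 0 then 1 else 0)"

text \<open>Time-energy cost of a unitary: max |theta_j| over its eigenvalues e^{i theta_j},
  theta_j in (-pi, pi]; Arg takes values in (-pi, pi].\<close>
definition unitary_cost :: "complex mat \<Rightarrow> real" where
  "unitary_cost U = Max {\<bar>Arg z\<bar> | z. eigenvalue U z}"

definition implements :: "nat \<Rightarrow> nat \<Rightarrow> complex mat \<Rightarrow> (complex mat \<Rightarrow> complex mat) \<Rightarrow> bool" where
  "implements m n U \<K> \<longleftrightarrow> (\<forall>\<rho>. density n \<rho> \<longrightarrow>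
      \<K> \<rho> = ptrace_B m n (U * kron m n (ket0bra0 m) \<rho> * adj U))"

definition channel_cost :: "nat \<Rightarrow> (complex mat \<Rightarrow> complex mat) \<Rightarrow> real" where
  "channel_cost n \<K> = Inf {unitary_cost U | U m. 0 < m \<and> unitary_mat (m*n) U \<and> implements m n U \<K>}"

definition mat_sum :: "nat \<Rightarrow> nat \<Rightarrow> (nat \<Rightarrow> complex mat) \<Rightarrow> complex mat" where
  "mat_sum n d f = mat n n (\<lambda>(i,k). \<Sum>j<d. f j $$ (i,k))"

definition kraus_channel :: "nat \<Rightarrow> nat \<Rightarrow> (nat \<Rightarrow> complex mat) \<Rightarrow> complex mat \<Rightarrow> complex mat" where
  "kraus_channel n d K \<rho> = mat_sum n d (\<lambda>j. K j * \<rho> * adj (K j))"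

end

theory Submission
  imports Defs
begin

text \<open>Write \<open>c = sqrt (r / n)\<close>; taking traces in \<open>\<Sum>\<^sub>j |s\<^sub>j|\<^sup>2 P\<^sub>j = 1\<close> gives \<open>\<Sum>\<^sub>j |s\<^sub>j|\<^sup>2 = n / r\<close>.

  Lower bound: a unitary with cost \<open>\<theta>\<close> has \<open>cos \<theta> \<le> Re U\<^sub>k\<^sub>k\<close> for all \<open>k\<close>, so \<open>n cos \<theta>\<close> is at most
  \<open>|tr F\<^sub>0|\<close>, where \<open>F\<^sub>0, F\<^sub>1, \<dots>\<close> are the Kraus operators in the first block column of \<open>U\<close>. The number
  \<open>\<Sum>\<^sub>i |tr F\<^sub>i|\<^sup>2\<close> depends only on the channel, and for the given Kraus operators it is \<open>r n\<close>.

  Upper bound: a change of Kraus representation makes \<open>F\<^sub>0 = c 1\<close>. The remaining \<open>F\<^sub>i\<close> then form a multiple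
  of an isometry \<open>W\<close>, and the rotation by \<open>arccos c\<close> in the planes spanned by \<open>|0\<rangle> \<otimes> \<psi>\<close> and \<open>W \<psi>\<close>
  implements the channel, with eigenvalues \<open>c \<plusminus> \<i> sqrt (1 - c\<^sup>2)\<close> and \<open>1\<close> only.\<close>

section \<open>Unitary matrices and their cost\<close>

text \<open>Rayleigh's principle: the quadratic form attains a minimum \<open>l\<close> on the unit
  sphere by compactness. A minimizer is an eigenvector because the first variation there vanishes,
  and homogeneity turns minimality into the last conclusion.\<close>

lemma hermitian_min_eigenvector:
  fixes h :: "nat \<Rightarrow> nat \<Rightarrow> complex"
  assumes "0 < N" and herm: "\<And>i j. i < N \<Longrightarrow> j < N \<Longrightarrow> h j i = cnj (h i j)"
  obtains l :: real and x where "\<exists>i<N. x i \<noteq> 0"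
    and "\<And>i. i < N \<Longrightarrow> (\<Sum>j<N. h i j * x j) = of_real l * x i"
    and "\<And>v. l * (\<Sum>i<N. (cmod (v i))\<^sup>2) \<le> Re (\<Sum>i<N. \<Sum>j<N. cnj (v i) * h i j * v j)"
proof -
  define q where "q v = Re (\<Sum>i<N. \<Sum>j<N. cnj (v i) * h i j * v j)" for v :: "nat \<Rightarrow> complex"
  define nn where "nn v = (\<Sum>i<N. (cmod (v i))\<^sup>2)" for v :: "nat \<Rightarrow> complex"
  \<comment> \<open>Vectors are functions on all of \<open>nat\<close>. Pinning the coordinates from
    \<open>N\<close> on to 0 makes \<open>C\<close> a product of compact sets, so Tychonoff's
    theorem applies.\<close>
  define C where "C = PiE UNIV (\<lambda>i. if i < N then cball (0::complex) 1 else {0})"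
  define S where "S = C \<inter> {v. nn v = 1}"
  have coord: "continuous_on UNIV (\<lambda>v :: nat \<Rightarrow> complex. v i)" for i
    by (rule continuous_on_product_coordinates)
  have "compactin (product_topology (\<lambda>i. euclidean) UNIV) C"
    unfolding C_def compactin_PiE by auto
  then have "compact C"
    by (simp add: euclidean_product_topology)
  moreover have "closed {v. nn v = 1}"
    unfolding nn_def by (intro closed_Collect_eq continuous_intros coord)
  ultimately have "compact S"
    unfolding S_def by (rule compact_Int_closed)
  moreover have "(\<lambda>i. if i = 0 then 1 else 0) \<in> S"
    using \<open>0 < N\<close> by (auto simp: S_def C_def nn_def if_distrib[of cmod] if_distrib[of "\<lambda>x. x^2"] cong: if_cong)
  moreover have "continuous_on S q"
    unfolding q_def by (intro continuous_intros continuous_on_subset[OF coord]) auto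
  ultimately obtain x where x: "x \<in> S" and min: "\<And>y. y \<in> S \<Longrightarrow> q x \<le> q y"
    by (metis continuous_attains_inf empty_iff)
  define l where "l = q x"
  have nx: "nn x = 1" using x by (simp add: S_def)
  have bound: "l * nn v \<le> q v" for v
  proof (cases "nn v = 0")
    case True
    then have "v i = 0" if "i < N" for i
      using that by (simp add: nn_def sum_nonneg_eq_0_iff)
    then have "q v = 0" by (simp add: q_def)
    with True show ?thesis by simp
  next
    case False
    then have pos: "nn v > 0" by (simp add: nn_def sum_nonneg less_le)
    define t where "t = sqrt (nn v)"
    have t: "t > 0" "t\<^sup>2 = nn v" using pos by (auto simp: t_def)
    \<comment> \<open>Normalise \<open>v\<close> and cut it off at \<open>N\<close>, so that it
      lands in \<open>S\<close>; both sides of the bound are homogeneous of degree 2.\<close>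
    define w where "w i = (if i < N then v i / of_real t else 0)" for i
    have "nn w = nn v / t\<^sup>2"
      unfolding nn_def w_def using t by (simp add: norm_divide power_divide sum_divide_distrib)
    then have nw: "nn w = 1" using t pos by simp
    have "cmod (w i) \<le> 1" if "i < N" for i
    proof -
      have "(cmod (w i))\<^sup>2 \<le> nn w"
        unfolding nn_def using that by (intro member_le_sum) auto
      with nw show ?thesis using power2_le_imp_le[of "cmod (w i)" 1] by simp
    qed
    then have "w \<in> S" using nw by (auto simp: S_def C_def w_def)
    then have "l \<le> q w" using min by (simp add: l_def)
    moreover have "q w = q v / t\<^sup>2"
    proof -
      have "(\<Sum>i<N. \<Sum>j<N. cnj (w i) * h i j * w j) = (\<Sum>i<N. \<Sum>j<N. cnj (v i) * h i j * v j) / of_real (t\<^sup>2)"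
        unfolding sum_divide_distrib w_def by (intro sum.cong refl) (simp add: power2_eq_square)
      then show ?thesis by (simp only: q_def Re_divide_of_real)
    qed
    ultimately show ?thesis using t pos by (simp add: field_simps)
  qed
  \<comment> \<open>The residual of the eigenvalue equation for \<open>x\<close>; it remains to show
    that it vanishes below \<open>N\<close>.\<close>
  define g where "g i = (\<Sum>j<N. h i j * x j) - of_real l * x i" for i
  have expand: "q (\<lambda>i. x i + of_real t * y i) = q x + 2 * t * Re (\<Sum>i<N. cnj (y i) * (\<Sum>j<N. h i j * x j)) + t\<^sup>2 * q y"
    for t y
  proof -
    define X Y where "X = (\<Sum>i<N. \<Sum>j<N. cnj (x i) * h i j * y j)"
      and "Y = (\<Sum>i<N. \<Sum>j<N. cnj (y i) * h i j * x j)"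
    have "X = cnj Y"
      unfolding X_def Y_def by (subst sum.swap) (auto intro!: sum.cong simp: herm[symmetric])
    then have "Re X = Re Y" by simp
    have "(\<Sum>i<N. cnj (y i) * (\<Sum>j<N. h i j * x j)) = Y"
      by (simp add: Y_def sum_distrib_left mult.assoc)
    moreover have "(\<Sum>i<N. \<Sum>j<N. cnj (x i + of_real t * y i) * h i j * (x j + of_real t * y j))
       = (\<Sum>i<N. \<Sum>j<N. cnj (x i) * h i j * x j) + of_real t * X + of_real t * Y
        + of_real (t\<^sup>2) * (\<Sum>i<N. \<Sum>j<N. cnj (y i) * h i j * y j)"
      unfolding X_def Y_def sum_distrib_left sum.distrib[symmetric]
      by (intro sum.cong refl) (simp add: algebra_simps power2_eq_square)
    ultimately show ?thesis
      using \<open>Re X = Re Y\<close> unfolding q_def by (simp only: plus_complex.sel times_complex.sel Re_complex_of_real Im_complex_of_real)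
  qed
  have nexpand: "nn (\<lambda>i. x i + of_real t * y i) = nn x + 2 * t * Re (\<Sum>i<N. cnj (y i) * x i) + t\<^sup>2 * nn y" for t y
    unfolding nn_def cmod_power2 Re_sum sum_distrib_left sum.distrib[symmetric]
    by (intro sum.cong refl) (simp add: algebra_simps power2_eq_square)
  text \<open>Minimality along the line through x in direction g forces the first variation, which is
    the squared length of g, to vanish.\<close>
  have G: "(\<Sum>i<N. cnj (g i) * (\<Sum>j<N. h i j * x j)) - of_real l * (\<Sum>i<N. cnj (g i) * x i) = of_real (nn g)"
    unfolding nn_def sum_distrib_left[of "of_real l"] sum_subtractf[symmetric] of_real_sum
  proof (intro sum.cong refl)
    fix i
    have "cnj (g i) * (\<Sum>j<N. h i j * x j) - of_real l * (cnj (g i) * x i)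
      = cnj (g i) * ((\<Sum>j<N. h i j * x j) - of_real l * x i)"
      by (simp only: right_diff_distrib mult.left_commute)
    also have "\<dots> = of_real ((cmod (g i))\<^sup>2)"
      unfolding g_def[symmetric] by (simp only: complex_norm_square mult.commute)
    finally show "cnj (g i) * (\<Sum>j<N. h i j * x j) - of_real l * (cnj (g i) * x i) = of_real ((cmod (g i))\<^sup>2)" .
  qed
  have "0 \<le> 2 * t * nn g + t\<^sup>2 * (q g - l * nn g)" for t
  proof -
    have "Re (\<Sum>i<N. cnj (g i) * (\<Sum>j<N. h i j * x j)) - l * Re (\<Sum>i<N. cnj (g i) * x i) = nn g"
      using arg_cong[OF G, of Re] by simp
    then have "2 * t * nn g = 2 * t * (Re (\<Sum>i<N. cnj (g i) * (\<Sum>j<N. h i j * x j)) - l * Re (\<Sum>i<N. cnj (g i) * x i))"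
      by simp
    then show ?thesis
      using bound[of "\<lambda>i. x i + of_real t * g i"] unfolding expand nexpand
      by (simp add: nx l_def algebra_simps)
  qed
  note quad = this
  have "nn g = 0"
  proof (rule ccontr)
    assume "nn g \<noteq> 0"
    then have a: "nn g > 0" by (simp add: nn_def sum_nonneg less_le)
    define b where "b = q g - l * nn g"
    have b: "b \<ge> 0" using bound[of g] by (simp add: b_def)
    \<comment> \<open>A step against \<open>g\<close> so small that the linear term dominates;
      \<open>b + 1\<close> instead of \<open>b\<close> avoids dividing by 0.\<close>
    define u where "u = nn g / (b + 1)"
    have u: "u > 0" "nn g = u * (b + 1)" using a b by (simp_all add: u_def)
    have "0 \<le> 2 * (- u) * nn g + (- u)\<^sup>2 * b"
      using quad[of "- u"] by (simp add: b_def)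
    also have "\<dots> = - (u\<^sup>2 * (b + 2))"
      unfolding u(2) by (simp add: algebra_simps power2_eq_square)
    also have "\<dots> < 0"
      using u b by simp
    finally show False by simp
  qed
  then have "g i = 0" if "i < N" for i
    using that by (simp add: nn_def sum_nonneg_eq_0_iff)
  then have "(\<Sum>j<N. h i j * x j) = of_real l * x i" if "i < N" for i
    using that by (simp add: g_def)
  moreover have "\<exists>i<N. x i \<noteq> 0"
  proof (rule ccontr)
    assume "\<not> (\<exists>i<N. x i \<noteq> 0)"
    then have "nn x = 0" by (simp add: nn_def)
    with nx show False by simp
  qed
  ultimately show thesis
    using that[of x l] bound by (simp add: q_def nn_def)
qed

section \<open>Adjoints, the spectrum of a unitary, and the cosine of its cost\<close>

lemma adj_carrier [simp]: "A \<in> carrier_mat m n \<Longrightarrow> adj A \<in> carrier_mat n m"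
  by (simp add: adj_def)

lemma index_adj [simp]: "i < dim_col A \<Longrightarrow> j < dim_row A \<Longrightarrow> adj A $$ (i,j) = cnj (A $$ (j,i))"
  by (simp add: adj_def)

lemma dim_adj [simp]: "dim_row (adj A) = dim_col A" "dim_col (adj A) = dim_row A"
  by (simp_all add: adj_def)

lemma adj_inner:
  assumes "A \<in> carrier_mat m n" "x \<in> carrier_vec n" "y \<in> carrier_vec m"
  shows "(A *\<^sub>v x) \<bullet>c y = x \<bullet>c (adj A *\<^sub>v y)"
proof -
  have "(A *\<^sub>v x) \<bullet>c y = (\<Sum>i<m. \<Sum>j<n. A $$ (i,j) * x $ j * cnj (y $ i))"
    using assms by (auto simp: scalar_prod_def atLeast0LessThan sum_distrib_right intro!: sum.cong)
  also have "\<dots> = (\<Sum>j<n. \<Sum>i<m. A $$ (i,j) * x $ j * cnj (y $ i))"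
    by (rule sum.swap)
  also have "\<dots> = x \<bullet>c (adj A *\<^sub>v y)"
    using assms by (auto simp: scalar_prod_def atLeast0LessThan sum_distrib_left mult_ac intro!: sum.cong)
  finally show ?thesis .
qed

lemma unitary_eigenvalue_cmod:
  assumes U: "unitary_mat N U" and ev: "eigenvalue U z"
  shows "cmod z = 1"
proof -
  have UN: "U \<in> carrier_mat N N" and UU: "adj U * U = 1\<^sub>m N"
    using U by (auto simp: unitary_mat_def)
  obtain x where x: "x \<in> carrier_vec N" "x \<noteq> 0\<^sub>v N" "U *\<^sub>v x = z \<cdot>\<^sub>v x"
    using ev UN by (auto simp: eigenvalue_def eigenvector_def)
  have "(U *\<^sub>v x) \<bullet>c (U *\<^sub>v x) = x \<bullet>c (adj U *\<^sub>v (U *\<^sub>v x))"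
    by (rule adj_inner[OF UN x(1) mult_mat_vec_carrier[OF UN x(1)]])
  also have "adj U *\<^sub>v (U *\<^sub>v x) = x"
    using assoc_mult_mat_vec[OF adj_carrier[OF UN] UN x(1)] UU x(1) by simp
  finally have "z * cnj z * (x \<bullet>c x) = x \<bullet>c x"
    using x by (simp add: conjugate_smult_vec mult.commute)
  moreover have "x \<bullet>c x \<noteq> 0"
    using x by simp
  ultimately have "z * cnj z = 1"
    by (metis mult_cancel_right1)
  then have "(cmod z)\<^sup>2 = 1"
    by (metis complex_norm_square of_real_eq_1_iff)
  then have "cmod z = 1 \<or> cmod z = - 1" by (simp only: power2_eq_1_iff)
  then show ?thesis using norm_ge_zero[of z] by linarith
qed

text \<open>An eigenspace of the Hermitian part of \<open>U\<close> is \<open>U\<close>-invariant, and there \<open>U\<close> is annihilated by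
  \<open>z\<^sup>2 - 2 l z + 1\<close>, whose roots on the unit circle have real part \<open>l\<close>.\<close>
lemma unitary_eigenvalue_Re_le_diag:
  assumes U: "unitary_mat N U" and "0 < N"
  obtains z where "eigenvalue U z" "\<And>k. k < N \<Longrightarrow> Re z \<le> Re (U $$ (k,k))"
proof -
  have UN: "U \<in> carrier_mat N N" and UU: "U * adj U = 1\<^sub>m N"
    using U by (auto simp: unitary_mat_def)
  \<comment> \<open>The Hermitian part of \<open>U\<close>; its diagonal entries are
    \<open>Re (U $$ (k,k))\<close>.\<close>
  define h where "h i j = (U $$ (i,j) + cnj (U $$ (j,i))) / 2" for i j
  have h2: "2 * h i j = U $$ (i,j) + cnj (U $$ (j,i))" for i j
    by (simp add: h_def)
  obtain l x where x: "\<exists>i<N. x i \<noteq> 0"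
    and hx: "\<And>i. i < N \<Longrightarrow> (\<Sum>j<N. h i j * x j) = of_real l * x i"
    and min: "\<And>v. l * (\<Sum>i<N. (cmod (v i))\<^sup>2) \<le> Re (\<Sum>i<N. \<Sum>j<N. cnj (v i) * h i j * v j)"
    by (rule hermitian_min_eigenvector[OF \<open>0 < N\<close>, of h]) (auto simp: h_def add.commute)
  \<comment> \<open>Test the Rayleigh bound on the basis vector \<open>?e\<close>.\<close>
  have le: "l \<le> Re (U $$ (k,k))" if "k < N" for k
  proof -
    let ?e = "\<lambda>i. if i = k then 1 else 0 :: complex"
    have "(\<Sum>i<N. (cmod (?e i))\<^sup>2) = (\<Sum>i<N. if i = k then 1 else 0)"
      by (intro sum.cong) auto
    moreover have "(\<Sum>i<N. \<Sum>j<N. cnj (?e i) * h i j * ?e j) = (\<Sum>i<N. if i = k then h k k else 0)"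
      using that by (intro sum.cong) (auto simp: if_distrib[of "\<lambda>x. _ * x"] cong: if_cong)
    ultimately have "l \<le> Re (h k k)"
      using min[of ?e] that by simp
    then show ?thesis by (simp add: h_def)
  qed
  define X where "X = vec N x"
  have X: "X \<in> carrier_vec N" "X \<noteq> 0\<^sub>v N"
    using x by (auto simp: X_def vec_eq_iff)
  have UX: "U *\<^sub>v X \<in> carrier_vec N" using UN X by simp
  have "(U *\<^sub>v X + adj U *\<^sub>v X) $ i = ((2 * of_real l) \<cdot>\<^sub>v X) $ i" if "i < N" for i
  proof -
    have "(U *\<^sub>v X + adj U *\<^sub>v X) $ i = (\<Sum>j<N. U $$ (i,j) * x j) + (\<Sum>j<N. cnj (U $$ (j,i)) * x j)"
      using UN that by (auto simp: X_def scalar_prod_def atLeast0LessThan intro!: arg_cong2[of _ _ _ _ "(+)"] sum.cong)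
    also have "\<dots> = 2 * (\<Sum>j<N. h i j * x j)"
      unfolding sum_distrib_left sum.distrib[symmetric] by (simp add: h2 mult.assoc[symmetric] distrib_right)
    finally show ?thesis using hx that by (simp add: X_def)
  qed
  then have "U *\<^sub>v X + adj U *\<^sub>v X = (2 * of_real l) \<cdot>\<^sub>v X"
    using UN X by (intro eq_vecI) auto
  then have "U *\<^sub>v (U *\<^sub>v X) + U *\<^sub>v (adj U *\<^sub>v X) = U *\<^sub>v ((2 * of_real l) \<cdot>\<^sub>v X)"
    using mult_add_distrib_mat_vec[OF UN UX mult_mat_vec_carrier[OF adj_carrier[OF UN] X(1)]] by simp
  moreover have "U *\<^sub>v (adj U *\<^sub>v X) = X"
    using assoc_mult_mat_vec[OF UN adj_carrier[OF UN] X(1)] UU X(1) by simp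
  \<comment> \<open>This is \<open>U\<close> applied to
    \<open>(U + adj U) X = 2 l X\<close>.\<close>
  ultimately have UUX: "U *\<^sub>v (U *\<^sub>v X) + X = (2 * of_real l) \<cdot>\<^sub>v (U *\<^sub>v X)"
    using mult_mat_vec[OF UN X(1)] by simp
  \<comment> \<open>\<open>z1\<close> and \<open>z2\<close> are the roots of
    \<open>z^2 - 2 l z + 1\<close>; the complex root avoids a case split on the sign of
    \<open>l^2 - 1\<close>.\<close>
  define w where "w = csqrt (of_real (l\<^sup>2 - 1))"
  have w2: "w * w = of_real l * of_real l - 1"
    unfolding w_def by (metis of_real_1 of_real_diff of_real_mult power2_csqrt power2_eq_square)
  define z1 z2 where "z1 = of_real l + w" and "z2 = of_real l - w"
  have zz: "z1 + z2 = 2 * of_real l" "z1 * z2 = 1"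
    using w2 by (auto simp: z1_def z2_def algebra_simps)
  \<comment> \<open>Since \<open>(U - z1) (U - z2) X = 0\<close>, either
    \<open>Y = (U - z2) X\<close> vanishes and \<open>X\<close> is an eigenvector for
    \<open>z2\<close>, or \<open>Y\<close> is one for \<open>z1\<close>.\<close>
  define Y where "Y = U *\<^sub>v X - z2 \<cdot>\<^sub>v X"
  have Y: "Y \<in> carrier_vec N" using UX X by (simp add: Y_def)
  have "U *\<^sub>v Y = U *\<^sub>v (U *\<^sub>v X) - z2 \<cdot>\<^sub>v (U *\<^sub>v X)"
    unfolding Y_def using mult_minus_distrib_mat_vec[OF UN UX, of "z2 \<cdot>\<^sub>v X"] mult_mat_vec[OF UN X(1)] X by simp
  also have "\<dots> = z1 \<cdot>\<^sub>v Y"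
  proof (rule eq_vecI)
    fix i assume "i < dim_vec (z1 \<cdot>\<^sub>v Y)"
    then have i: "i < N" using Y by simp
    have "(U *\<^sub>v (U *\<^sub>v X)) $ i + X $ i = 2 * of_real l * (U *\<^sub>v X) $ i"
      using arg_cong[OF UUX, of "\<lambda>v. v $ i"] i UX X UN by simp
    then have "(U *\<^sub>v (U *\<^sub>v X)) $ i = (z1 + z2) * (U *\<^sub>v X) $ i - z1 * z2 * X $ i"
      using zz by (simp add: algebra_simps)
    then show "(U *\<^sub>v (U *\<^sub>v X) - z2 \<cdot>\<^sub>v (U *\<^sub>v X)) $ i = (z1 \<cdot>\<^sub>v Y) $ i"
      using i UX X UN by (simp add: Y_def algebra_simps del: index_mult_mat_vec)
  qed (use UX X UN Y in auto)
  finally have UY: "U *\<^sub>v Y = z1 \<cdot>\<^sub>v Y" .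
  have "\<exists>z. eigenvalue U z \<and> z * z = 2 * of_real l * z - 1"
  proof (cases "Y = 0\<^sub>v N")
    case True
    have "(U *\<^sub>v X) $ i = (z2 \<cdot>\<^sub>v X) $ i" if "i < N" for i
      using arg_cong[OF True, of "\<lambda>v. v $ i"] that X UX UN by (simp add: Y_def del: index_mult_mat_vec)
    then have "U *\<^sub>v X = z2 \<cdot>\<^sub>v X"
      using UX X UN by (intro eq_vecI) auto
    then have "eigenvalue U z2"
      using X UN by (auto simp: eigenvalue_def eigenvector_def)
    moreover have "z2 * z2 = 2 * of_real l * z2 - 1"
      by (simp only: zz[symmetric]) (simp add: algebra_simps)
    ultimately show ?thesis by blast
  next
    case False
    then have "eigenvalue U z1"
      using Y UN UY by (auto simp: eigenvalue_def eigenvector_def)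
    moreover have "z1 * z1 = 2 * of_real l * z1 - 1"
      by (simp only: zz[symmetric]) (simp add: algebra_simps)
    ultimately show ?thesis by blast
  qed
  then obtain z where ev: "eigenvalue U z" and z: "z * z = 2 * of_real l * z - 1" by blast
  have "z * cnj z = 1"
    using unitary_eigenvalue_cmod[OF U ev] by (simp add: complex_norm_square[symmetric])
  \<comment> \<open>Multiplying the quadratic equation by \<open>cnj z\<close>, the inverse of
    \<open>z\<close>, gives \<open>z + cnj z = 2 l\<close>.\<close>
  then have e: "z = 2 * of_real l - cnj z"
    using arg_cong[OF z, of "\<lambda>u. u * cnj z"] by (simp add: algebra_simps)
  have "Re z = l" using arg_cong[OF e, of Re] by simp
  then show thesis using that[OF ev] le by simp
qed

text \<open>Eigenvalues are roots of the monic characteristic polynomial. Finiteness is what makes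
  the \<open>Max\<close> in \<open>unitary_cost\<close> meaningful.\<close>

lemma finite_eigenvalues:
  assumes "A \<in> carrier_mat N N"
  shows "finite {z :: complex. eigenvalue A z}"
proof -
  have "char_poly A \<noteq> 0"
    using degree_monic_char_poly[OF assms] by auto
  then show ?thesis
    using poly_roots_finite by (simp add: eigenvalue_root_char_poly[OF assms])
qed

text \<open>On the unit circle \<open>Re z = cos \<bar>Arg z\<bar>\<close>, and \<open>cos\<close>
  decreases on \<open>[0, pi]\<close>. Hence the cosine of the largest angle is below the real part
  of every eigenvalue, in particular of the one that lies below the diagonal.\<close>

lemma unitary_cost_bounds:
  assumes U: "unitary_mat N U" and "0 < N"
  shows "0 \<le> unitary_cost U" "unitary_cost U \<le> pi"
    and "k < N \<Longrightarrow> cos (unitary_cost U) \<le> Re (U $$ (k,k))"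
    and "\<exists>z. eigenvalue U z \<and> unitary_cost U = \<bar>Arg z\<bar>"
proof -
  obtain z where z: "eigenvalue U z" and zk: "\<And>k. k < N \<Longrightarrow> Re z \<le> Re (U $$ (k,k))"
    using unitary_eigenvalue_Re_le_diag[OF U \<open>0 < N\<close>] by blast
  let ?A = "{\<bar>Arg z\<bar> |z. eigenvalue U z}"
  have fin: "finite ?A"
    using finite_eigenvalues[of U N] U by (simp add: unitary_mat_def setcompr_eq_image)
  have "unitary_cost U \<in> ?A"
    unfolding unitary_cost_def using fin z by (intro Max_in) auto
  then show ex: "\<exists>z. eigenvalue U z \<and> unitary_cost U = \<bar>Arg z\<bar>" by blast
  have "\<bar>Arg z\<bar> \<le> pi" for z
    using Arg_bounded[of z] by (auto simp: abs_le_iff)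
  with ex show b: "0 \<le> unitary_cost U" "unitary_cost U \<le> pi" by auto
  have "\<bar>Arg z\<bar> \<le> unitary_cost U"
    unfolding unitary_cost_def using fin z by (intro Max_ge) auto
  then have "cos (unitary_cost U) \<le> cos (\<bar>Arg z\<bar>)"
    using b by (intro cos_monotone_0_pi_le) auto
  also have "\<dots> = Re z"
    using cos_Arg[of z] unitary_eigenvalue_cmod[OF U z] by (cases "z = 0") (auto simp: abs_if)
  finally show "k < N \<Longrightarrow> cos (unitary_cost U) \<le> Re (U $$ (k,k))"
    using zk by fastforce
qed

section \<open>The trace of an idempotent\<close>

text \<open>Full-rank factorisation: \<open>P = A * B\<close>, where the columns of \<open>A\<close>
  are a basis of the column space chosen among the columns of \<open>P\<close>. Idempotence forces
  \<open>B * A = 1\<close>, so cyclicity of the trace gives the rank.\<close>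

lemma trace_idempotent_eq_rank:
  fixes P :: "complex mat"
  assumes P: "P \<in> carrier_mat n n" and idem: "P * P = P"
  shows "tr n P = of_nat (vec_space.rank n P)"
proof -
  interpret vec_space "TYPE(complex)" n .
  let ?r = "rank P"
  have colsP: "set (cols P) \<subseteq> carrier_vec n"
    using P cols_dim by blast
  obtain S where S: "finite S" "maximal S (\<lambda>T. T \<subseteq> set (cols P) \<and> lin_indpt T)"
    using maximal_exists_superset[of "set (cols P)" "\<lambda>T. T \<subseteq> set (cols P) \<and> lin_indpt T" "{}"]
    by (auto simp: lin_dep_def)
  then have Ssub: "S \<subseteq> set (cols P)" and Sli: "lin_indpt S"
    by (auto simp: maximal_def)
  have rS: "card S = ?r"
    using rank_card_indpt[OF P S(2)] by simp
  obtain ws where ws: "set ws = S" "distinct ws"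
    using finite_distinct_list[OF S(1)] by blast
  then have len: "length ws = ?r" using rS distinct_card by fastforce
  have wsn: "set ws \<subseteq> carrier_vec n" using ws Ssub colsP by blast
  define A where "A = mat_of_cols n ws"
  have A: "A \<in> carrier_mat n ?r" by (simp add: A_def len[symmetric])
  have cA: "cols A = ws" using wsn by (simp add: A_def)
  have "\<exists>b. w = A *\<^sub>v b \<and> b \<in> carrier_vec ?r" if w: "w \<in> set (cols P)" for w
  proof -
    have "w \<in> span S"
    proof (cases "w \<in> S")
      case True
      then show ?thesis using Ssub colsP span_mem by (meson subset_trans)
    next
      case False
      then have "\<not> lin_indpt (insert w S)"
        using S(2) w Ssub unfolding maximal_def by blast
      then show ?thesis
        using lin_dep_iff_in_span[of S w] False Sli Ssub colsP w by auto
    qed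
    then obtain f where "w = lincomb f S"
      using finite_in_span[OF S(1)] Ssub colsP by (metis subset_trans)
    then have "w = lincomb_list (\<lambda>i. f (ws ! i)) ws"
      using lincomb_as_lincomb_list_distinct[OF wsn ws(2)] ws(1) by simp
    then have "w = A *\<^sub>v vec (length ws) (\<lambda>i. f (ws ! i))"
      using lincomb_list_as_mat_mult[of ws "\<lambda>i. f (ws ! i)"] wsn carrier_vecD by (fastforce simp: A_def)
    then show ?thesis using len by (metis vec_carrier)
  qed
  then obtain b where b: "\<And>w. w \<in> set (cols P) \<Longrightarrow> w = A *\<^sub>v b w \<and> b w \<in> carrier_vec ?r"
    by metis
  define B where "B = mat_of_cols ?r (map b (cols P))"
  have B: "B \<in> carrier_mat ?r n" using P by (auto simp: B_def)
  have "P = A * B"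
  proof (rule mat_col_eqI)
    fix j assume "j < dim_col (A * B)"
    then have j: "j < n" using B by simp
    then have m: "col P j \<in> set (cols P)"
      using P by (metis carrier_matD(2) cols_length cols_nth nth_mem)
    have "col (A * B) j = A *\<^sub>v col B j" by (rule col_mult2[OF A B j])
    also have "col B j = b (col P j)"
      using b[OF m] j P unfolding B_def by (subst col_mat_of_cols) auto
    finally show "col P j = col (A * B) j" using b[OF m] by simp
  qed (use P A B in auto)
  \<comment> \<open>The columns of \<open>A\<close> are columns of \<open>P\<close>, and
    \<open>P\<close> fixes its own columns.\<close>
  have "P * A = A"
  proof (rule mat_col_eqI)
    fix j assume "j < dim_col A"
    then have j: "j < ?r" using A by simp
    have "col A j \<in> set (cols P)"
      using cA ws(1) Ssub A j by (metis carrier_matD(2) cols_length cols_nth nth_mem subsetD)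
    then obtain k where k: "k < n" "col A j = col P k"
      using P by (metis carrier_matD(2) cols_length cols_nth in_set_conv_nth)
    have "col (P * A) j = P *\<^sub>v col P k" using col_mult2[OF P A j] k by simp
    also have "\<dots> = col (P * P) k" by (rule col_mult2[OF P P k(1), symmetric])
    finally show "col (P * A) j = col A j" using idem k by simp
  qed (use P A in auto)
  \<comment> \<open>\<open>A * (B * A) = P * A = A\<close>, and \<open>A\<close> can be cancelled on
    the left because its columns are independent.\<close>
  have "B * A = 1\<^sub>m ?r"
  proof (rule mat_col_eqI)
    fix j assume "j < dim_col (1\<^sub>m ?r :: complex mat)"
    then have j: "j < ?r" by simp
    define v where "v = col (B * A) j - col (1\<^sub>m ?r) j"
    have v: "v \<in> carrier_vec ?r" using A B by (intro carrier_vecI) (simp add: v_def)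
    have "A *\<^sub>v v = A *\<^sub>v col (B * A) j - A *\<^sub>v col (1\<^sub>m ?r) j"
      unfolding v_def by (rule mult_minus_distrib_mat_vec[OF A]; rule carrier_vecI) (use B in simp_all)
    also have "A *\<^sub>v col (B * A) j = col (A * (B * A)) j" by (rule col_mult2[OF A mult_carrier_mat[OF B A] j, symmetric])
    also have "A * (B * A) = A"
      using \<open>P = A * B\<close> \<open>P * A = A\<close> assoc_mult_mat[OF A B A] by simp
    also have "A *\<^sub>v col (1\<^sub>m ?r) j = col A j"
      using A j by (metis col_mult2 one_carrier_mat right_mult_one_mat)
    also have "col A j - col A j = 0\<^sub>v n" using A j by (intro eq_vecI) auto
    finally have "A *\<^sub>v v = 0\<^sub>v n" .
    then have "v = 0\<^sub>v ?r"
      using lin_depI[OF A v] cA ws Sli by auto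
    then have "v $ i = 0" if "i < ?r" for i using that by simp
    then show "col (B * A) j = col (1\<^sub>m ?r) j"
      using A B unfolding v_def by (intro eq_vecI) auto
  qed (use A B in auto)
  have "tr n (A * B) = (\<Sum>i<n. \<Sum>k<?r. A $$ (i,k) * B $$ (k,i))"
    unfolding tr_def using A B by (auto simp: scalar_prod_def atLeast0LessThan intro!: sum.cong)
  also have "\<dots> = (\<Sum>k<?r. \<Sum>i<n. B $$ (k,i) * A $$ (i,k))"
    by (subst sum.swap) (simp add: mult.commute)
  also have "\<dots> = (\<Sum>k<?r. (B * A) $$ (k,k))"
    using A B by (auto simp: scalar_prod_def atLeast0LessThan intro!: sum.cong)
  also have "\<dots> = of_nat ?r"
    using \<open>B * A = 1\<^sub>m ?r\<close> by simp
  finally show ?thesis using \<open>P = A * B\<close> by simp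
qed

section \<open>Kraus representations and the lower bound\<close>

text \<open>The ancilla state selects the first \<open>n\<close> columns of \<open>U\<close>. The
  \<open>n\<close> by \<open>n\<close> blocks stacked there, with entries
  \<open>U $$ (b*n+k, a)\<close>, are Kraus operators of the implemented map.\<close>

lemma ptrace_dilation_entry:
  assumes U: "U \<in> carrier_mat (m*n) (m*n)" and "0 < m" and R: "R \<in> carrier_mat n n" and kl: "k < n" "l < n"
  shows "ptrace_B m n (U * kron m n (ket0bra0 m) R * adj U) $$ (k,l) =
    (\<Sum>b<m. \<Sum>a<n. \<Sum>c<n. U $$ (b*n+k, a) * R $$ (a,c) * cnj (U $$ (b*n+l, c)))"
proof -
  let ?M = "kron m n (ket0bra0 m) R"
  have M: "?M \<in> carrier_mat (m*n) (m*n)" by (simp add: kron_def)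
  have nm: "n \<le> m * n" using \<open>0 < m\<close> by simp
  then have lt: "x < m * n" if "x < n" for x using that by linarith
  have Me: "?M $$ (x,y) = (if x < n \<and> y < n then R $$ (x,y) else 0)" if "x < m*n" "y < m*n" for x y
  proof -
    have "x div n < m" "y div n < m" using that by (auto simp: less_mult_imp_div_less)
    moreover have "0 < n" using kl by simp
    ultimately show ?thesis
      using that by (auto simp: kron_def ket0bra0_def div_eq_0_iff)
  qed
  have entry: "(U * ?M * adj U) $$ (p,q) = (\<Sum>a<n. \<Sum>c<n. U $$ (p,a) * R $$ (a,c) * cnj (U $$ (q,c)))"
    if pq: "p < m*n" "q < m*n" for p q
  proof -
    have "(U * ?M * adj U) $$ (p,q) = (\<Sum>y<m*n. (\<Sum>x<m*n. U $$ (p,x) * ?M $$ (x,y)) * cnj (U $$ (q,y)))"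
      using U M pq by (auto simp: scalar_prod_def atLeast0LessThan simp del: assoc_mult_mat intro!: sum.cong)
    also have "\<dots> = (\<Sum>y<m*n. if y < n then (\<Sum>x<n. U $$ (p,x) * R $$ (x,y)) * cnj (U $$ (q,y)) else 0)"
    proof (intro sum.cong refl)
      fix y assume y: "y \<in> {..<m*n}"
      have "(\<Sum>x<m*n. U $$ (p,x) * ?M $$ (x,y)) = (\<Sum>x<n. if y < n then U $$ (p,x) * R $$ (x,y) else 0)"
        using nm y lt by (intro sum.mono_neutral_cong_right) (auto simp: Me)
      then show "(\<Sum>x<m*n. U $$ (p,x) * ?M $$ (x,y)) * cnj (U $$ (q,y)) =
        (if y < n then (\<Sum>x<n. U $$ (p,x) * R $$ (x,y)) * cnj (U $$ (q,y)) else 0)"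
        by simp
    qed
    also have "\<dots> = (\<Sum>y<n. (\<Sum>x<n. U $$ (p,x) * R $$ (x,y)) * cnj (U $$ (q,y)))"
      using nm lt by (intro sum.mono_neutral_cong_right) auto
    also have "\<dots> = (\<Sum>a<n. \<Sum>c<n. U $$ (p,a) * R $$ (a,c) * cnj (U $$ (q,c)))"
      unfolding sum_distrib_right by (rule sum.swap)
    finally show ?thesis .
  qed
  have "b * n + k < m * n" if "b < m" "k < n" for b k
  proof -
    have "b * n + k < Suc b * n" using that by simp
    also have "\<dots> \<le> m * n" using that by (intro mult_le_mono1) simp
    finally show ?thesis .
  qed
  then show ?thesis
    using kl by (simp add: ptrace_B_def entry)
qed

text \<open>Brings the channel into the same triple-sum form as
  \<open>ptrace_dilation_entry\<close>, ready for comparison.\<close>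

lemma kraus_channel_entry:
  assumes K: "\<And>j. j < d \<Longrightarrow> K j \<in> carrier_mat n n" and R: "R \<in> carrier_mat n n" and kl: "k < n" "l < n"
  shows "kraus_channel n d K R $$ (k,l) =
    (\<Sum>j<d. \<Sum>a<n. \<Sum>c<n. K j $$ (k,a) * R $$ (a,c) * cnj (K j $$ (l,c)))"
proof -
  have "(K j * R * adj (K j)) $$ (k,l) = (\<Sum>a<n. \<Sum>c<n. K j $$ (k,a) * R $$ (a,c) * cnj (K j $$ (l,c)))"
    if j: "j < d" for j
  proof -
    have "(K j * R * adj (K j)) $$ (k,l) = (\<Sum>c<n. (\<Sum>a<n. K j $$ (k,a) * R $$ (a,c)) * cnj (K j $$ (l,c)))"
      using K[OF j] R kl by (auto simp: scalar_prod_def atLeast0LessThan simp del: assoc_mult_mat intro!: sum.cong)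
    also have "\<dots> = (\<Sum>a<n. \<Sum>c<n. K j $$ (k,a) * R $$ (a,c) * cnj (K j $$ (l,c)))"
      unfolding sum_distrib_right by (rule sum.swap)
    finally show ?thesis .
  qed
  then show ?thesis using kl by (simp add: kraus_channel_def mat_sum_def)
qed

text \<open>Pure states are the test inputs: \<open>implements\<close> gives information on density
  matrices only.\<close>

lemma density_rank_one:
  assumes "(\<Sum>i<n. (cmod (v i))\<^sup>2) = 1"
  shows "density n (mat n n (\<lambda>(i,j). v i * cnj (v j)))"
proof -
  let ?R = "mat n n (\<lambda>(i,j). v i * cnj (v j))"
  have "(\<Sum>i<n. \<Sum>j<n. cnj (u i) * ?R $$ (i,j) * u j) = of_real ((cmod (\<Sum>i<n. cnj (u i) * v i))\<^sup>2)" for u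
  proof -
    have "(\<Sum>i<n. \<Sum>j<n. cnj (u i) * ?R $$ (i,j) * u j) = (\<Sum>i<n. cnj (u i) * v i) * (\<Sum>j<n. cnj (v j) * u j)"
      unfolding sum_product by (intro sum.cong refl) simp
    also have "(\<Sum>j<n. cnj (v j) * u j) = cnj (\<Sum>i<n. cnj (u i) * v i)"
      by (simp add: mult.commute)
    finally show ?thesis by (simp add: complex_norm_square del: of_real_power)
  qed
  then have "psd n ?R"
    by (simp add: psd_def del: of_real_power)
  moreover have "tr n ?R = of_real (\<Sum>i<n. (cmod (v i))\<^sup>2)"
    unfolding tr_def of_real_sum by (intro sum.cong refl) (simp add: complex_norm_square del: of_real_power)
  ultimately show ?thesis using assms by (simp add: density_def)
qed

text \<open>Polarisation over the complex numbers, with \<open>v\<close> supported on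
  \<open>p\<close> and \<open>q\<close>.\<close>

lemma sesquilinear_form_zero:
  fixes T :: "nat \<Rightarrow> nat \<Rightarrow> complex"
  assumes zero: "\<And>v. (\<Sum>a<n. \<Sum>c<n. T a c * v a * cnj (v c)) = 0" and pq: "p < n" "q < n"
  shows "T p q = 0"
proof -
  have *: "T p p * \<alpha> * cnj \<alpha> + T p q * \<alpha> * cnj \<beta> + T q p * \<beta> * cnj \<alpha> + T q q * \<beta> * cnj \<beta> = 0" for \<alpha> \<beta>
  proof -
    define D where "D r x = (\<lambda>i. if i = r then x else 0 :: complex)" for r :: nat and x
    have S: "(\<Sum>a<n. \<Sum>c<n. T a c * D r x a * cnj (D s y c)) = T r s * x * cnj y" if "r < n" "s < n" for r s x y
    proof -
      have "(\<Sum>a<n. \<Sum>c<n. T a c * D r x a * cnj (D s y c)) = (\<Sum>a<n. if a = r then T r s * x * cnj y else 0)"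
        unfolding D_def using that
        by (intro sum.cong) (auto simp: if_distrib[of cnj] if_distrib[of "\<lambda>x. _ * x"] cong: if_cong)
      then show ?thesis using that by simp
    qed
    have "(\<Sum>a<n. \<Sum>c<n. T a c * (D p \<alpha> a + D q \<beta> a) * cnj (D p \<alpha> c + D q \<beta> c)) =
       (\<Sum>a<n. \<Sum>c<n. T a c * D p \<alpha> a * cnj (D p \<alpha> c)) + (\<Sum>a<n. \<Sum>c<n. T a c * D p \<alpha> a * cnj (D q \<beta> c))
       + (\<Sum>a<n. \<Sum>c<n. T a c * D q \<beta> a * cnj (D p \<alpha> c)) + (\<Sum>a<n. \<Sum>c<n. T a c * D q \<beta> a * cnj (D q \<beta> c))"
      unfolding sum.distrib[symmetric] by (intro sum.cong refl) (simp add: algebra_simps)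
    then show ?thesis
      using zero[of "\<lambda>a. D p \<alpha> a + D q \<beta> a"] pq by (simp add: S)
  qed
  \<comment> \<open>The vectors \<open>(1,0)\<close> and \<open>(0,1)\<close> remove the diagonal
    terms; \<open>(1,1)\<close> and \<open>(1,\<i>)\<close> then give the sum and the difference of
    the two off-diagonal entries.\<close>
  have "T p p = 0" using *[of 1 0] by simp
  moreover have "T q q = 0" using *[of 0 1] by simp
  ultimately have "T p q + T q p = 0" "- (T p q * \<i>) + T q p * \<i> = 0"
    using *[of 1 1] *[of 1 \<i>] by simp_all
  then show ?thesis by (simp add: algebra_simps)
qed

text \<open>The sum \<open>\<Sum>\<^sub>b |tr F\<^sub>b|\<^sup>2\<close> over Kraus operators is a contraction of the Choi matrix (the entanglement
  fidelity, up to \<open>n\<^sup>2\<close>), so it is the same for all Kraus representations of a channel.\<close>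
lemma sum_cmod_trace_implements:
  assumes U: "U \<in> carrier_mat (m*n) (m*n)" and "0 < m"
    and K: "\<And>j. j < d \<Longrightarrow> K j \<in> carrier_mat n n"
    and imp: "implements m n U (kraus_channel n d K)"
  shows "(\<Sum>b<m. (cmod (\<Sum>k<n. U $$ (b*n+k, k)))\<^sup>2) = (\<Sum>j<d. (cmod (tr n (K j)))\<^sup>2)"
proof -
  \<comment> \<open>The difference of the two Choi matrices. For fixed output entry
    \<open>(k,l)\<close> it is a sesquilinear form in the input vector.\<close>
  define T where "T k l a c = (\<Sum>b<m. U $$ (b*n+k, a) * cnj (U $$ (b*n+l, c)))
    - (\<Sum>j<d. K j $$ (k,a) * cnj (K j $$ (l,c)))" for k l a c
  have T0: "T k l p q = 0" if kl: "k < n" "l < n" and pq: "p < n" "q < n" for k l p q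
  proof (rule sesquilinear_form_zero[where T = "T k l" and n = n, OF _ pq])
    fix v :: "nat \<Rightarrow> complex"
    define N where "N = (\<Sum>i<n. (cmod (v i))\<^sup>2)"
    show "(\<Sum>a<n. \<Sum>c<n. T k l a c * v a * cnj (v c)) = 0"
    proof (cases "N = 0")
      case True
      then show ?thesis by (simp add: N_def sum_nonneg_eq_0_iff)
    next
      case False
      then have N: "N > 0" by (simp add: N_def sum_nonneg less_le)
      \<comment> \<open>Rescale to unit length, since only inputs of trace 1 may be
        compared.\<close>
      define t where "t = sqrt N"
      have t: "t > 0" "t\<^sup>2 = N" using N by (auto simp: t_def)
      define w where "w i = v i / of_real t" for i
      have vw: "v i = of_real t * w i" for i using t by (simp add: w_def)
      have "(\<Sum>i<n. (cmod (w i))\<^sup>2) = N / t\<^sup>2"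
        unfolding w_def N_def using t by (simp add: norm_divide power_divide sum_divide_distrib)
      then have nw: "(\<Sum>i<n. (cmod (w i))\<^sup>2) = 1" using t N by simp
      define R where "R = mat n n (\<lambda>(i,j). w i * cnj (w j))"
      have R: "R \<in> carrier_mat n n" by (simp add: R_def)
      have "kraus_channel n d K R = ptrace_B m n (U * kron m n (ket0bra0 m) R * adj U)"
        using imp density_rank_one[OF nw] by (simp add: implements_def R_def)
      then have e: "(\<Sum>b<m. \<Sum>a<n. \<Sum>c<n. U $$ (b*n+k, a) * R $$ (a,c) * cnj (U $$ (b*n+l, c)))
        = (\<Sum>j<d. \<Sum>a<n. \<Sum>c<n. K j $$ (k,a) * R $$ (a,c) * cnj (K j $$ (l,c)))"
        using ptrace_dilation_entry[OF U \<open>0 < m\<close> R kl] kraus_channel_entry[where K = K and d = d, OF K R kl] by simp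
      have swap: "(\<Sum>b<e. \<Sum>a<n. \<Sum>c<n. f b a * R $$ (a,c) * g b c)
        = (\<Sum>a<n. \<Sum>c<n. (\<Sum>b<e. f b a * g b c) * w a * cnj (w c))" for e :: nat and f g
      proof -
        have "(\<Sum>b<e. \<Sum>a<n. \<Sum>c<n. f b a * R $$ (a,c) * g b c) = (\<Sum>a<n. \<Sum>b<e. \<Sum>c<n. f b a * R $$ (a,c) * g b c)"
          by (rule sum.swap)
        also have "\<dots> = (\<Sum>a<n. \<Sum>c<n. \<Sum>b<e. f b a * R $$ (a,c) * g b c)"
          by (intro sum.cong refl sum.swap)
        also have "\<dots> = (\<Sum>a<n. \<Sum>c<n. (\<Sum>b<e. f b a * g b c) * w a * cnj (w c))"
          unfolding sum_distrib_right by (intro sum.cong refl) (simp add: R_def)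
        finally show ?thesis .
      qed
      have "(\<Sum>a<n. \<Sum>c<n. T k l a c * w a * cnj (w c)) = 0"
        using e unfolding swap T_def by (simp add: algebra_simps sum_subtractf)
      then show ?thesis
        unfolding vw by (simp add: sum_distrib_left[symmetric] mult_ac)
    qed
  qed
  have expand: "complex_of_real (\<Sum>b<e. (cmod (\<Sum>k<n. f b k k))\<^sup>2) = (\<Sum>k<n. \<Sum>l<n. \<Sum>b<e. f b k k * cnj (f b l l))"
    for e :: nat and f :: "nat \<Rightarrow> nat \<Rightarrow> nat \<Rightarrow> complex"
  proof -
    have "complex_of_real (\<Sum>b<e. (cmod (\<Sum>k<n. f b k k))\<^sup>2) = (\<Sum>b<e. \<Sum>k<n. \<Sum>l<n. f b k k * cnj (f b l l))"
      unfolding of_real_sum by (intro sum.cong refl) (simp add: complex_norm_square sum_product del: of_real_power)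
    also have "\<dots> = (\<Sum>k<n. \<Sum>b<e. \<Sum>l<n. f b k k * cnj (f b l l))"
      by (rule sum.swap)
    also have "\<dots> = (\<Sum>k<n. \<Sum>l<n. \<Sum>b<e. f b k k * cnj (f b l l))"
      by (intro sum.cong refl sum.swap)
    finally show ?thesis .
  qed
  have "complex_of_real (\<Sum>b<m. (cmod (\<Sum>k<n. U $$ (b*n+k, k)))\<^sup>2) = complex_of_real (\<Sum>j<d. (cmod (tr n (K j)))\<^sup>2)"
    unfolding tr_def expand[of "\<lambda>b k l. U $$ (b*n+k, l)"] expand[of "\<lambda>j k l. K j $$ (k,l)"]
  proof (rule sum.cong[OF refl], rule sum.cong[OF refl])
    fix k l assume "k \<in> {..<n}" "l \<in> {..<n}"
    then show "(\<Sum>b<m. U $$ (b*n+k, k) * cnj (U $$ (b*n+l, l))) = (\<Sum>j<d. K j $$ (k,k) * cnj (K j $$ (l,l)))"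
      using T0[of k l k l] by (simp add: T_def)
  qed
  then show ?thesis by (simp only: of_real_eq_iff)
qed

text \<open>The first \<open>n\<close> diagonal entries of \<open>U\<close> add up to the trace of
  its top-left block, and the squared modulus of that trace is one summand of the channel
  invariant.\<close>

lemma cos_unitary_cost_le:
  assumes U: "unitary_mat (m*n) U" and "0 < m" "0 < n"
    and K: "\<And>j. j < d \<Longrightarrow> K j \<in> carrier_mat n n"
    and imp: "implements m n U (kraus_channel n d K)"
  shows "real n * cos (unitary_cost U) \<le> sqrt (\<Sum>j<d. (cmod (tr n (K j)))\<^sup>2)"
proof -
  have N: "0 < m * n" using assms by simp
  have UN: "U \<in> carrier_mat (m*n) (m*n)" using U by (simp add: unitary_mat_def)
  have "real n * cos (unitary_cost U) = (\<Sum>k<n. cos (unitary_cost U))" by simp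
  also have "\<dots> \<le> (\<Sum>k<n. Re (U $$ (k,k)))"
  proof (intro sum_mono unitary_cost_bounds(3)[OF U N])
    fix k assume "k \<in> {..<n}"
    moreover have "n \<le> m * n" using \<open>0 < m\<close> by simp
    ultimately show "k < m * n" by (meson lessThan_iff less_le_trans)
  qed
  also have "\<dots> = Re (\<Sum>k<n. U $$ (k,k))" by simp
  also have "\<dots> \<le> cmod (\<Sum>k<n. U $$ (k,k))" by (rule complex_Re_le_cmod)
  also have "\<dots> \<le> sqrt (\<Sum>b<m. (cmod (\<Sum>k<n. U $$ (b*n+k, k)))\<^sup>2)"
  proof (rule real_le_rsqrt)
    \<comment> \<open>Written with \<open>0*n+k\<close> to match the summand for
      \<open>b = 0\<close>.\<close>
    have "(cmod (\<Sum>k<n. U $$ (0*n+k, k)))\<^sup>2 \<le> (\<Sum>b<m. (cmod (\<Sum>k<n. U $$ (b*n+k, k)))\<^sup>2)"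
      using \<open>0 < m\<close> by (intro member_le_sum) auto
    then show "(cmod (\<Sum>k<n. U $$ (k, k)))\<^sup>2 \<le> (\<Sum>b<m. (cmod (\<Sum>k<n. U $$ (b*n+k, k)))\<^sup>2)" by simp
  qed
  also have "(\<Sum>b<m. (cmod (\<Sum>k<n. U $$ (b*n+k, k)))\<^sup>2) = (\<Sum>j<d. (cmod (tr n (K j)))\<^sup>2)"
    by (rule sum_cmod_trace_implements[OF UN \<open>0 < m\<close> K imp])
  finally show ?thesis .
qed

section \<open>Rotation dilations\<close>

lemma mult_index_sum:
  assumes "A \<in> carrier_mat m n" "B \<in> carrier_mat n l" "i < m" "j < l"
  shows "(A * B) $$ (i,j) = (\<Sum>k<n. A $$ (i,k) * B $$ (k,j))"
  using assms by (auto simp: scalar_prod_def atLeast0LessThan intro!: sum.cong)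

lemma sum_lessThan_add:
  fixes f :: "nat \<Rightarrow> 'a::comm_monoid_add"
  shows "(\<Sum>i<m+n. f i) = (\<Sum>i<m. f i) + (\<Sum>i<n. f (m+i))"
  by (induction n) (simp_all add: add.assoc)

text \<open>For sums over the rows of \<open>d\<close> stacked blocks: row \<open>i\<close> is row
  \<open>i mod n\<close> of block \<open>i div n\<close>.\<close>

lemma sum_div_mod:
  fixes f :: "nat \<Rightarrow> nat \<Rightarrow> 'a::comm_monoid_add"
  shows "(\<Sum>i<d*n. f (i div n) (i mod n)) = (\<Sum>j<d. \<Sum>k<n. f j k)"
proof -
  have "(\<Sum>i<d*n. f (i div n) (i mod n)) = (\<Sum>j<d. \<Sum>i=j*n..<j*n+n. f (i div n) (i mod n))"
    by (rule sum.nat_group[symmetric])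
  also have "\<dots> = (\<Sum>j<d. \<Sum>k<n. f j k)"
  proof (rule sum.cong[OF refl])
    fix j
    have "(\<Sum>i=j*n..<j*n+n. f (i div n) (i mod n)) = (\<Sum>k=0..<n. f ((k + j*n) div n) ((k + j*n) mod n))"
      using sum.shift_bounds_nat_ivl[of "\<lambda>i. f (i div n) (i mod n)" 0 "j*n" n] by (simp add: add.commute)
    then show "(\<Sum>i=j*n..<j*n+n. f (i div n) (i mod n)) = (\<Sum>k<n. f j k)"
      by (simp add: atLeast0LessThan)
  qed
  finally show ?thesis .
qed

text \<open>Rotates \<open>E \<psi>\<close> (first block) by the angle \<open>arccos c\<close> in the plane spanned by \<open>E \<psi>\<close> and \<open>X \<psi>\<close>, and
  fixes the orthogonal complement. The coefficient \<open>1 / (1 + c) = (1 - c) / (1 - c\<^sup>2)\<close> is written so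
  that it remains meaningful for \<open>c = 1\<close>.\<close>
definition rotation_dilation :: "nat \<Rightarrow> nat \<Rightarrow> real \<Rightarrow> complex mat \<Rightarrow> complex mat" where
  "rotation_dilation n M c X = four_block_mat (of_real c \<cdot>\<^sub>m 1\<^sub>m n) (- adj X) X
     (1\<^sub>m M - of_real (1 / (1 + c)) \<cdot>\<^sub>m (X * adj X))"

context
  fixes n M :: nat and c :: real and X :: "complex mat"
  assumes X: "X \<in> carrier_mat M n" and c: "0 \<le> c"
    and XX: "adj X * X = of_real (1 - c\<^sup>2) \<cdot>\<^sub>m 1\<^sub>m n"
begin

text \<open>Blockwise computation. With \<open>H = X * adj X\<close>, the hypothesis on
  \<open>X\<close> reduces \<open>adj X * H\<close>, \<open>H * X\<close> and \<open>H * H\<close>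
  to multiples by \<open>e = 1 - c^2\<close>, and the scalars cancel by \<open>k * e = 1 - c\<close>
  and \<open>k * (1 + c) = 1\<close>.\<close>

lemma rotation_dilation_unitary: "unitary_mat (n + M) (rotation_dilation n M c X)"
proof -
  define k where "k = complex_of_real (1 / (1 + c))"
  define e where "e = complex_of_real (1 - c\<^sup>2)"
  define H where "H = X * adj X"
  have A: "adj X \<in> carrier_mat n M" using X by simp
  have H: "H \<in> carrier_mat M M" unfolding H_def by (rule mult_carrier_mat[OF X A])
  note one = left_mult_one_mat[OF A] right_mult_one_mat[OF A] left_mult_one_mat[OF X] right_mult_one_mat[OF X]
    left_mult_one_mat[OF H] right_mult_one_mat[OF H]
  have ke: "k * e = 1 - of_real c"
  proof -
    have "1 / (1 + c) * (1 - c\<^sup>2) = 1 - c" using c by (simp add: field_simps power2_eq_square)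
    then show ?thesis unfolding k_def e_def by (metis of_real_1 of_real_diff of_real_mult)
  qed
  have kc: "k * (1 + of_real c) = 1"
  proof -
    have "1 / (1 + c) * (1 + c) = 1" using c by simp
    then show ?thesis unfolding k_def by (metis of_real_1 of_real_add of_real_mult)
  qed
  have cancel: "of_real c * y + (k * (e * y) - y) = 0" for y
  proof -
    have "of_real c * y + (k * (e * y) - y) = (k * e - (1 - of_real c)) * y"
      by (simp only: left_diff_distrib mult.assoc) simp
    then show ?thesis by (simp only: ke) simp
  qed
  have ce: "of_real c * of_real c + e = 1" by (simp add: e_def power2_eq_square)
  have AH: "adj X * H = e \<cdot>\<^sub>m adj X"
    using XX assoc_mult_mat[OF A X A] mult_smult_assoc_mat[OF one_carrier_mat A] by (simp add: H_def e_def one)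
  have HX: "H * X = e \<cdot>\<^sub>m X"
    using XX assoc_mult_mat[OF X A X] mult_smult_distrib[OF X one_carrier_mat] by (simp add: H_def e_def one)
  have HH: "H * H = e \<cdot>\<^sub>m H"
    using HX assoc_mult_mat[OF H X A] mult_smult_assoc_mat[OF X A] by (simp add: H_def)
  let ?U = "rotation_dilation n M c X"
  have kH: "k \<cdot>\<^sub>m H \<in> carrier_mat M M" using H by simp
  have D: "1\<^sub>m M - k \<cdot>\<^sub>m H \<in> carrier_mat M M" by (rule minus_carrier_mat[OF kH])
  have C1: "of_real c \<cdot>\<^sub>m 1\<^sub>m n \<in> carrier_mat n n" by simp
  have U: "?U = four_block_mat (of_real c \<cdot>\<^sub>m 1\<^sub>m n) (- adj X) X (1\<^sub>m M - k \<cdot>\<^sub>m H)"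
    by (simp add: rotation_dilation_def k_def H_def)
  have UN: "?U \<in> carrier_mat (n+M) (n+M)"
    using D C1 unfolding U by (intro four_block_carrier_mat)
  have Hadj: "cnj (H $$ (j,i)) = H $$ (i,j)" if "i < M" "j < M" for i j
    using that X A unfolding H_def by (simp add: mult_index_sum[OF X A] mult.commute del: index_mult_mat)
  have aU: "adj ?U = four_block_mat (of_real c \<cdot>\<^sub>m 1\<^sub>m n) (adj X) (- X) (1\<^sub>m M - k \<cdot>\<^sub>m H)"
    unfolding U using X H Hadj by (intro eq_matI) (auto simp: k_def)
  have "?U * adj ?U = four_block_mat
      ((of_real c \<cdot>\<^sub>m 1\<^sub>m n) * (of_real c \<cdot>\<^sub>m 1\<^sub>m n) + (- adj X) * (- X))
      ((of_real c \<cdot>\<^sub>m 1\<^sub>m n) * adj X + (- adj X) * (1\<^sub>m M - k \<cdot>\<^sub>m H))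
      (X * (of_real c \<cdot>\<^sub>m 1\<^sub>m n) + (1\<^sub>m M - k \<cdot>\<^sub>m H) * (- X))
      (X * adj X + (1\<^sub>m M - k \<cdot>\<^sub>m H) * (1\<^sub>m M - k \<cdot>\<^sub>m H))"
    unfolding aU unfolding U using X A D by (intro mult_four_block_mat) auto
  also have "(of_real c \<cdot>\<^sub>m 1\<^sub>m n) * (of_real c \<cdot>\<^sub>m 1\<^sub>m n) + (- adj X) * (- X) = 1\<^sub>m n"
  proof -
    have "(- adj X) * (- X) = e \<cdot>\<^sub>m 1\<^sub>m n" using X A XX by (simp add: e_def)
    moreover have "(of_real c \<cdot>\<^sub>m 1\<^sub>m n) * (of_real c \<cdot>\<^sub>m 1\<^sub>m n) = of_real c \<cdot>\<^sub>m (of_real c \<cdot>\<^sub>m (1\<^sub>m n :: complex mat))"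
      by (simp add: mult_smult_assoc_mat[OF one_carrier_mat C1] left_mult_one_mat[OF C1])
    ultimately show ?thesis using ce by (intro eq_matI) auto
  qed
  also have "(of_real c \<cdot>\<^sub>m 1\<^sub>m n) * adj X + (- adj X) * (1\<^sub>m M - k \<cdot>\<^sub>m H) = 0\<^sub>m n M"
  proof -
    have "(- adj X) * (1\<^sub>m M - k \<cdot>\<^sub>m H) = - (adj X - k \<cdot>\<^sub>m (e \<cdot>\<^sub>m adj X))"
      using mult_minus_distrib_mat[OF A one_carrier_mat kH] mult_smult_distrib[OF A H] A AH H X by (simp add: one)
    moreover have "(of_real c \<cdot>\<^sub>m 1\<^sub>m n) * adj X = of_real c \<cdot>\<^sub>m adj X"
      using mult_smult_assoc_mat[OF one_carrier_mat A] by (simp add: one)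
    ultimately show ?thesis
      using A X by (intro eq_matI) (auto simp: cancel simp del: of_real_power)
  qed
  also have "X * (of_real c \<cdot>\<^sub>m 1\<^sub>m n) + (1\<^sub>m M - k \<cdot>\<^sub>m H) * (- X) = 0\<^sub>m M n"
  proof -
    have "(1\<^sub>m M - k \<cdot>\<^sub>m H) * (- X) = - (X - k \<cdot>\<^sub>m (e \<cdot>\<^sub>m X))"
      using minus_mult_distrib_mat[OF one_carrier_mat kH X] mult_smult_assoc_mat[OF H X] X HX H by (simp add: one)
    moreover have "X * (of_real c \<cdot>\<^sub>m 1\<^sub>m n) = of_real c \<cdot>\<^sub>m X"
      using mult_smult_distrib[OF X one_carrier_mat] by (simp add: one)
    ultimately show ?thesis
      using X by (intro eq_matI) (auto simp: cancel)
  qed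
  also have "X * adj X + (1\<^sub>m M - k \<cdot>\<^sub>m H) * (1\<^sub>m M - k \<cdot>\<^sub>m H) = 1\<^sub>m M"
  proof -
    have sq: "(1\<^sub>m M - k \<cdot>\<^sub>m H) * (1\<^sub>m M - k \<cdot>\<^sub>m H) = 1\<^sub>m M - k \<cdot>\<^sub>m H - (k \<cdot>\<^sub>m H - k \<cdot>\<^sub>m (k \<cdot>\<^sub>m (e \<cdot>\<^sub>m H)))"
      using minus_mult_distrib_mat[OF one_carrier_mat kH D] mult_minus_distrib_mat[OF kH one_carrier_mat kH]
        mult_smult_assoc_mat[OF H kH] mult_smult_distrib[OF H H] H HH kH by (simp add: one)
    \<comment> \<open>As \<open>2 - k * e = 1 + c\<close>, the last factor is
      \<open>1 - k * (1 + c) = 0\<close>.\<close>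
    have quad: "h + (k * (k * (e * h)) - 2 * (k * h)) = 0" for h
    proof -
      have "h + (k * (k * (e * h)) - 2 * (k * h)) = h * (1 - k * (2 - k * e))"
        by (simp add: algebra_simps)
      then show ?thesis using kc unfolding ke by simp
    qed
    show ?thesis
      unfolding sq using H by (intro eq_matI) (auto simp: H_def[symmetric] quad)
  qed
  finally have "?U * adj ?U = 1\<^sub>m (n + M)" by simp
  then show ?thesis
    using UN mat_mult_left_right_inverse[OF UN adj_carrier[OF UN]] by (simp add: unitary_mat_def)
qed

text \<open>Split an eigenvector into its first block \<open>a\<close> and the rest
  \<open>b\<close>. If \<open>a\<close> is nonzero, adding the first blocks of
  \<open>U x = z x\<close> and \<open>adj U x = cnj z x\<close> cancels the terms in
  \<open>adj X b\<close> and leaves \<open>z + cnj z = 2 c\<close>.\<close>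

lemma rotation_dilation_eigenvalue:
  assumes ev: "eigenvalue (rotation_dilation n M c X) z"
  shows "z = 1 \<or> Re z = c"
proof -
  let ?U = "rotation_dilation n M c X"
  let ?k = "complex_of_real (1 / (1 + c))"
  let ?D = "1\<^sub>m M - ?k \<cdot>\<^sub>m (X * adj X)"
  have UN: "?U \<in> carrier_mat (n+M) (n+M)" and UU: "adj ?U * ?U = 1\<^sub>m (n + M)"
    using rotation_dilation_unitary by (auto simp: unitary_mat_def)
  have A: "adj X \<in> carrier_mat n M" using X by simp
  have D: "?D \<in> carrier_mat M M" by (intro minus_carrier_mat smult_carrier_mat mult_carrier_mat[OF X A])
  obtain x where x: "x \<in> carrier_vec (n+M)" "x \<noteq> 0\<^sub>v (n+M)" "?U *\<^sub>v x = z \<cdot>\<^sub>v x"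
    using ev UN by (auto simp: eigenvalue_def eigenvector_def)
  define a b where "a = vec_first x n" and "b = vec_last x M"
  have ab: "a \<in> carrier_vec n" "b \<in> carrier_vec M" "x = a @\<^sub>v b"
    using x by (simp_all add: a_def b_def)
  have block: "?U *\<^sub>v x = (of_real c \<cdot>\<^sub>m 1\<^sub>m n *\<^sub>v a + - adj X *\<^sub>v b) @\<^sub>v (X *\<^sub>v a + ?D *\<^sub>v b)"
    unfolding rotation_dilation_def ab(3)
    by (rule four_block_mat_mult_vec) (use X D ab in auto)
  have top: "of_real c * a $ i - (adj X *\<^sub>v b) $ i = z * a $ i" if i: "i < n" for i
  proof -
    have "(?U *\<^sub>v x) $ i = (of_real c \<cdot>\<^sub>m 1\<^sub>m n *\<^sub>v a) $ i - (adj X *\<^sub>v b) $ i"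
      unfolding block using i X ab by simp
    moreover have "of_real c \<cdot>\<^sub>m 1\<^sub>m n *\<^sub>v a = of_real c \<cdot>\<^sub>v a"
      using ab by (intro eq_vecI) (auto simp: scalar_prod_def sum.delta if_distrib[of "\<lambda>x. _ * x"] if_distrib[of "\<lambda>x. x * _"] cong: if_cong)
    ultimately show ?thesis using x(3) i ab by simp
  qed
  show ?thesis
  proof (cases "a = 0\<^sub>v n")
    \<comment> \<open>Now the first block equation says \<open>adj X b = 0\<close>, so the lower
      right block fixes \<open>b\<close>, which is nonzero; hence \<open>z = 1\<close>.\<close>
    case True
    have Xb: "adj X *\<^sub>v b = 0\<^sub>v n"
      using top True X by (intro eq_vecI) auto
    have "X * adj X *\<^sub>v b = X *\<^sub>v (adj X *\<^sub>v b)"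
      using X A ab by (intro assoc_mult_mat_vec) auto
    then have "X * adj X *\<^sub>v b = 0\<^sub>v M"
      using Xb X by auto
    moreover have smult_zero_vec: "?k \<cdot>\<^sub>v 0\<^sub>v M = 0\<^sub>v M"
      by (intro eq_vecI) auto
    moreover have "(?k \<cdot>\<^sub>m (X * adj X)) *\<^sub>v b = ?k \<cdot>\<^sub>v (X * adj X *\<^sub>v b)"
      using ab X by (intro eq_vecI) auto
    ultimately have "?D *\<^sub>v b = b"
      using minus_mult_distrib_mat_vec[OF one_carrier_mat smult_carrier_mat[OF mult_carrier_mat[OF X A]] ab(2), of ?k] ab(2)
      by (simp only: one_mult_mat_vec minus_zero_vec)
    moreover have "X *\<^sub>v a = 0\<^sub>v M"
      using X True by (intro eq_vecI) auto
    ultimately have "z \<cdot>\<^sub>v x = (of_real c \<cdot>\<^sub>m 1\<^sub>m n *\<^sub>v a + - adj X *\<^sub>v b) @\<^sub>v b"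
      using block x(3) ab(2) by simp
    then have zb: "(z \<cdot>\<^sub>v x) $ (n + i) = b $ i" if "i < M" for i
      using that ab X by simp
    have "b \<noteq> 0\<^sub>v M"
    proof
      assume "b = 0\<^sub>v M"
      then have "x = 0\<^sub>v (n + M)"
        unfolding ab(3) True by (intro eq_vecI) auto
      with x(2) show False ..
    qed
    then obtain i where i: "i < M" "b $ i \<noteq> 0"
      using ab(2) by (metis carrier_vecD eq_vecI index_zero_vec)
    have "z * b $ i = b $ i"
      using zb[OF i(1)] i(1) ab by simp
    then show ?thesis using i by simp
  next
    case False
    then obtain i where i: "i < n" "a $ i \<noteq> 0"
      using ab by (auto simp: vec_eq_iff)
    have zz: "z * cnj z = 1"
      using unitary_eigenvalue_cmod[OF rotation_dilation_unitary ev] by (simp add: complex_norm_square[symmetric])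
    \<comment> \<open>Apply \<open>adj U\<close> to the eigenvalue equation; as \<open>z\<close> has
      modulus 1, \<open>x\<close> is an eigenvector of \<open>adj U\<close> for
      \<open>cnj z\<close>.\<close>
    have "z \<cdot>\<^sub>v (adj ?U *\<^sub>v x) = x"
      using assoc_mult_mat_vec[OF adj_carrier[OF UN] UN x(1)] UU x mult_mat_vec[OF adj_carrier[OF UN] x(1)] by simp
    then have "cnj z * (z * (adj ?U *\<^sub>v x) $ i) = cnj z * x $ i"
      using i UN by (metis adj_carrier carrier_matD(1) dim_mult_mat_vec index_smult_vec(1) trans_less_add1)
    then have "(adj ?U *\<^sub>v x) $ i = cnj z * a $ i"
      using zz i ab by (simp add: mult.assoc[symmetric] mult.commute[of "cnj z"] del: index_mult_mat_vec)
    moreover have "(adj ?U *\<^sub>v x) $ i = of_real c * a $ i + (adj X *\<^sub>v b) $ i"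
    proof -
      have r: "adj ?U $$ (i,j) = (if j < n then of_real c * (if i = j then 1 else 0) else adj X $$ (i, j - n))" if "j < n + M" for j
        using that i UN X by (auto simp: rotation_dilation_def)
      have "(adj ?U *\<^sub>v x) $ i = (\<Sum>j<n+M. adj ?U $$ (i,j) * x $ j)"
        using i UN x(1) by (auto simp: scalar_prod_def atLeast0LessThan)
      also have "\<dots> = (\<Sum>j<n. adj ?U $$ (i,j) * x $ j) + (\<Sum>j<M. adj ?U $$ (i,n+j) * x $ (n+j))"
        by (rule sum_lessThan_add)
      also have "(\<Sum>j<n. adj ?U $$ (i,j) * x $ j) = (\<Sum>j<n. if i = j then of_real c * a $ i else 0)"
        using r ab by (intro sum.cong) auto
      also have "(\<Sum>j<M. adj ?U $$ (i,n+j) * x $ (n+j)) = (adj X *\<^sub>v b) $ i"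
        using r ab X i by (auto simp: scalar_prod_def atLeast0LessThan intro!: sum.cong)
      finally show ?thesis using i by simp
    qed
    ultimately have "cnj z * a $ i = of_real c * a $ i + (adj X *\<^sub>v b) $ i"
      by simp
    then have "z * a $ i + cnj z * a $ i = 2 * of_real c * a $ i"
      unfolding top[OF i(1), symmetric] by simp
    then have "2 * of_real c * a $ i = (z + cnj z) * a $ i"
      by (simp only: distrib_right)
    then have "2 * of_real c = z + cnj z" using i by simp
    from arg_cong[OF this, of Re] show ?thesis by simp
  qed
qed

text \<open>Eigenvalue 1 has angle 0 and real part \<open>c\<close> means angle
  \<open>arccos c\<close> up to sign. Equality is left to the general lower bound, so no eigenvector
  with real part \<open>c\<close> has to be exhibited.\<close>

lemma rotation_dilation_cost:
  assumes "c \<le> 1" "0 < n"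
  shows "unitary_cost (rotation_dilation n M c X) \<le> arccos c"
proof -
  let ?U = "rotation_dilation n M c X"
  obtain z where ev: "eigenvalue ?U z" and z: "unitary_cost ?U = \<bar>Arg z\<bar>"
    using unitary_cost_bounds(4)[OF rotation_dilation_unitary] assms by auto
  show ?thesis
  proof (cases "z = 1")
    case True
    then show ?thesis using z c assms arccos_lbound by simp
  next
    case False
    then have "Re z = c" using rotation_dilation_eigenvalue[OF ev] by blast
    moreover have "cmod z = 1" by (rule unitary_eigenvalue_cmod[OF rotation_dilation_unitary ev])
    ultimately have "cos \<bar>Arg z\<bar> = c"
      using cos_Arg[of z] by (cases "z = 0") (auto simp: abs_if)
    moreover have "\<bar>Arg z\<bar> \<le> pi" using Arg_bounded[of z] by (auto simp: abs_le_iff)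
    ultimately show ?thesis using z arccos_cos[of "\<bar>Arg z\<bar>"] by simp
  qed
qed

end

section \<open>Channels of scaled projectors\<close>

locale scaled_projectors =
  fixes n d r :: nat and s :: "nat \<Rightarrow> complex" and P K :: "nat \<Rightarrow> complex mat"
  assumes n: "0 < n"
    and P: "j < d \<Longrightarrow> P j \<in> carrier_mat n n"
    and idem: "j < d \<Longrightarrow> P j * P j = P j"
    and selfadj: "j < d \<Longrightarrow> adj (P j) = P j"
    and rank: "j < d \<Longrightarrow> vec_space.rank n (P j) = r"
    and K: "j < d \<Longrightarrow> K j = s j \<cdot>\<^sub>m P j"
    and complete: "mat_sum n d (\<lambda>j. adj (K j) * K j) = 1\<^sub>m n"
begin

text \<open>A real weight typed as complex, so that it multiplies matrix entries without
  coercions.\<close>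

definition w :: "nat \<Rightarrow> complex" where "w j = of_real ((cmod (s j))\<^sup>2)"

definition \<delta> :: "nat \<Rightarrow> nat \<Rightarrow> complex" where "\<delta> a b = (if a = b then 1 else 0)"

lemma w_conv: "w j = cnj (s j) * s j" "w j = s j * cnj (s j)"
  by (simp_all only: w_def complex_norm_square mult.commute)

lemma K_carrier: "j < d \<Longrightarrow> K j \<in> carrier_mat n n"
  using K P by simp

lemma cnj_P: "j < d \<Longrightarrow> a < n \<Longrightarrow> b < n \<Longrightarrow> cnj (P j $$ (a,b)) = P j $$ (b,a)"
  using index_adj[of b "P j" a] P[of j] selfadj[of j] by simp

lemma P_square: "j < d \<Longrightarrow> a < n \<Longrightarrow> b < n \<Longrightarrow> (\<Sum>k<n. P j $$ (a,k) * P j $$ (k,b)) = P j $$ (a,b)"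
  using mult_index_sum[OF P P, of j j a b] idem[of j] by simp

text \<open>The completeness relation, read entrywise: \<open>adj (K j) * K j\<close> is
  \<open>w j\<close> times \<open>P j\<close>, because \<open>P j\<close> is a self-adjoint
  idempotent.\<close>

lemma sum_w_P:
  assumes ab: "a < n" "b < n"
  shows "(\<Sum>j<d. w j * P j $$ (a,b)) = \<delta> a b"
proof -
  have "\<delta> a b = mat_sum n d (\<lambda>j. adj (K j) * K j) $$ (a,b)"
    using ab unfolding complete by (simp add: \<delta>_def)
  also have "\<dots> = (\<Sum>j<d. (adj (K j) * K j) $$ (a,b))"
    using ab by (simp add: mat_sum_def)
  also have "\<dots> = (\<Sum>j<d. w j * P j $$ (a,b))"
  proof (rule sum.cong[OF refl])
    fix j assume "j \<in> {..<d}"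
    then have j: "j < d" by simp
    have "(adj (K j) * K j) $$ (a,b) = (\<Sum>k<n. adj (K j) $$ (a,k) * K j $$ (k,b))"
      by (rule mult_index_sum[OF adj_carrier[OF K_carrier[OF j]] K_carrier[OF j] ab])
    also have "\<dots> = (\<Sum>k<n. w j * (P j $$ (a,k) * P j $$ (k,b)))"
    proof (rule sum.cong[OF refl])
      fix k assume "k \<in> {..<n}"
      then show "adj (K j) $$ (a,k) * K j $$ (k,b) = w j * (P j $$ (a,k) * P j $$ (k,b))"
        using j ab P[OF j] by (simp add: K cnj_P w_conv(1))
    qed
    finally show "(adj (K j) * K j) $$ (a,b) = w j * P j $$ (a,b)"
      using P_square[OF j ab] by (simp add: sum_distrib_left[symmetric])
  qed
  finally show ?thesis by simp
qed

lemma trace_P: "j < d \<Longrightarrow> tr n (P j) = of_nat r"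
  using trace_idempotent_eq_rank[OF P idem] rank by simp

lemma sum_w_rank: "(\<Sum>j<d. w j) * of_nat r = of_nat n"
proof -
  have "(\<Sum>j<d. w j) * of_nat r = (\<Sum>j<d. w j * tr n (P j))"
    by (simp add: trace_P sum_distrib_right)
  also have "\<dots> = (\<Sum>j<d. \<Sum>a<n. w j * P j $$ (a,a))"
    by (simp add: tr_def sum_distrib_left)
  also have "\<dots> = (\<Sum>a<n. \<Sum>j<d. w j * P j $$ (a,a))"
    by (rule sum.swap)
  also have "\<dots> = of_nat n" by (simp add: sum_w_P \<delta>_def)
  finally show ?thesis .
qed

lemma r_pos: "0 < r"
proof (rule ccontr)
  assume "\<not> 0 < r"
  then show False using sum_w_rank n by simp
qed

lemma r_le_n: "r \<le> n"
proof -
  \<comment> \<open>With \<open>d = 0\<close> the empty sum in \<open>sum_w_rank\<close> would force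
    \<open>n = 0\<close>.\<close>
  have "0 < d" using sum_w_rank n by (cases d) auto
  then have "r = vec_space.rank n (P 0)" using rank by simp
  also have "\<dots> \<le> n" by (rule vec_space.rank_le_nc[OF P[OF \<open>0 < d\<close>]])
  finally show ?thesis .
qed

definition c :: real where "c = sqrt (real r / real n)"

lemma c_nonneg: "0 \<le> c" and c_le_one: "c \<le> 1"
  using r_le_n n by (simp_all add: c_def)

lemma c2: "c\<^sup>2 = real r / real n"
  by (simp add: c_def)

abbreviation cc :: complex where "cc \<equiv> of_real (c\<^sup>2)"

text \<open>Says that \<open>c\<close> times the vector of the \<open>s j\<close> is a unit vector;
  the change of Kraus representation below relies on this.\<close>

lemma sum_w: "cc * (\<Sum>j<d. w j) = 1"
proof -
  have "cc * (\<Sum>j<d. w j) = (\<Sum>j<d. w j) * of_nat r / of_nat n"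
    unfolding c2 by simp
  then show ?thesis unfolding sum_w_rank using n by simp
qed

section \<open>The lower bound for scaled projectors\<close>

lemma sum_cmod_trace: "(\<Sum>j<d. (cmod (tr n (K j)))\<^sup>2) = real r * real n"
proof -
  have t: "tr n (K j) = s j * of_nat r" if "j < d" for j
    using that P[OF that] trace_P[OF that] by (simp add: tr_def K sum_distrib_left[symmetric])
  have "(\<Sum>j<d. (cmod (tr n (K j)))\<^sup>2) = (\<Sum>j<d. (cmod (s j))\<^sup>2) * real r * real r"
    unfolding sum_distrib_right by (intro sum.cong refl) (simp add: t norm_mult power2_eq_square)
  moreover have "(\<Sum>j<d. (cmod (s j))\<^sup>2) * real r = real n"
  proof -
    have "complex_of_real ((\<Sum>j<d. (cmod (s j))\<^sup>2) * real r) = complex_of_real (real n)"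
      using sum_w_rank by (simp add: w_def)
    then show ?thesis by (simp only: of_real_eq_iff)
  qed
  ultimately show ?thesis by simp
qed

text \<open>The invariant is \<open>r * n\<close>, whose root is \<open>n * c\<close>, so the cosine
  of the cost is at most \<open>c\<close>. The cost lies in \<open>[0, pi]\<close>, where
  \<open>arccos\<close> inverts \<open>cos\<close>.\<close>

lemma arccos_le_unitary_cost:
  assumes U: "unitary_mat (m*n) U" and m: "0 < m" and imp: "implements m n U (kraus_channel n d K)"
  shows "arccos c \<le> unitary_cost U"
proof -
  have "real n * cos (unitary_cost U) \<le> sqrt (real r * real n)"
    using cos_unitary_cost_le[where K = K, OF U m n K_carrier imp] sum_cmod_trace by simp
  also have "\<dots> = real n * c"
    using n by (simp add: c_def real_sqrt_mult real_sqrt_divide real_div_sqrt field_simps)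
  finally have "cos (unitary_cost U) \<le> c"
    using n by simp
  then have "arccos c \<le> arccos (cos (unitary_cost U))"
    using c_nonneg c_le_one by (intro arccos_le_mono[THEN iffD2]) auto
  also have "\<dots> = unitary_cost U"
    using unitary_cost_bounds(1,2)[OF U] m n by (intro arccos_cos) auto
  finally show ?thesis .
qed

text \<open>Together with \<open>c 1\<^sub>n\<close>, the blocks \<open>s\<^sub>j (P\<^sub>j - c\<^sup>2 1\<^sub>n)\<close> of \<open>X\<close> are again Kraus operators of the
  channel: they are the image of \<open>(K\<^sub>j)\<close> under the projection of the index space \<open>\<complex>\<^sup>d\<close> orthogonal to
  the unit vector \<open>c s\<close>.\<close>
definition X :: "complex mat" where
  "X = mat (d*n) n (\<lambda>(i,a). s (i div n) * (P (i div n) $$ (i mod n, a) - cc * \<delta> (i mod n) a))"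

text \<open>Equality of the Choi matrices of the two Kraus families. By \<open>sum_w_P\<close> each
  cross term contributes \<open>- c^2 \<delta> \<delta>\<close>, and by \<open>sum_w\<close> the
  last term contributes \<open>+ c^2 \<delta> \<delta>\<close>; the first summand compensates for
  the total.\<close>

lemma choi_identity:
  assumes "k < n" "a < n" "l < n" "b < n"
  shows "cc * \<delta> k a * \<delta> l b + (\<Sum>j<d. s j * (P j $$ (k,a) - cc * \<delta> k a) * cnj (s j * (P j $$ (l,b) - cc * \<delta> l b)))
    = (\<Sum>j<d. K j $$ (k,a) * cnj (K j $$ (l,b)))"
proof -
  have "(\<Sum>j<d. s j * (P j $$ (k,a) - cc * \<delta> k a) * cnj (s j * (P j $$ (l,b) - cc * \<delta> l b)))
    = (\<Sum>j<d. K j $$ (k,a) * cnj (K j $$ (l,b)) - cc * \<delta> l b * (w j * P j $$ (k,a))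
        - cc * \<delta> k a * (w j * P j $$ (b,l)) + cc * (cc * \<delta> k a * \<delta> l b) * w j)"
  proof (rule sum.cong[OF refl])
    fix j assume "j \<in> {..<d}"
    then have j: "j < d" by simp
    have "cnj (\<delta> l b) = \<delta> l b" by (simp add: \<delta>_def)
    then show "s j * (P j $$ (k,a) - cc * \<delta> k a) * cnj (s j * (P j $$ (l,b) - cc * \<delta> l b))
      = K j $$ (k,a) * cnj (K j $$ (l,b)) - cc * \<delta> l b * (w j * P j $$ (k,a))
        - cc * \<delta> k a * (w j * P j $$ (b,l)) + cc * (cc * \<delta> k a * \<delta> l b) * w j"
      using j assms P[OF j] by (simp add: K cnj_P w_conv(2) algebra_simps del: of_real_power)
  qed
  also have "\<dots> = (\<Sum>j<d. K j $$ (k,a) * cnj (K j $$ (l,b))) - cc * \<delta> l b * \<delta> k a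
        - cc * \<delta> k a * \<delta> b l + cc * \<delta> k a * \<delta> l b * (cc * (\<Sum>j<d. w j))"
    by (simp add: sum.distrib sum_subtractf sum_distrib_left[symmetric] sum_w_P assms del: of_real_power)
  finally show ?thesis
    unfolding sum_w by (simp add: \<delta>_def)
qed

text \<open>\<open>(P - c^2)^2 = (1 - 2 c^2) P + c^4\<close> for a projector \<open>P\<close>.
  Summed with the weights \<open>w j\<close>, of total \<open>1 / c^2\<close>, this gives
  \<open>(1 - 2 c^2) + c^2\<close>.\<close>

lemma X_isometry: "adj X * X = of_real (1 - c\<^sup>2) \<cdot>\<^sub>m 1\<^sub>m n"
proof (rule eq_matI)
  fix a b assume "a < dim_row (of_real (1 - c\<^sup>2) \<cdot>\<^sub>m (1\<^sub>m n :: complex mat))"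
    "b < dim_col (of_real (1 - c\<^sup>2) \<cdot>\<^sub>m (1\<^sub>m n :: complex mat))"
  then have ab: "a < n" "b < n" by auto
  have X: "X \<in> carrier_mat (d*n) n" by (simp add: X_def)
  have delta: "(\<Sum>k<n. \<delta> k i * f k) = f i" if "i < n" for i f
  proof -
    have "(\<Sum>k<n. \<delta> k i * f k) = (\<Sum>k<n. if k = i then f i else 0)"
      by (intro sum.cong) (auto simp: \<delta>_def)
    then show ?thesis using that by simp
  qed
  have "(adj X * X) $$ (a,b) = (\<Sum>i<d*n. adj X $$ (a,i) * X $$ (i,b))"
    by (rule mult_index_sum[OF adj_carrier[OF X] X ab])
  \<comment> \<open>The abstraction exposes the shape \<open>f (i div n) (i mod n)\<close> that
    \<open>sum_div_mod\<close> expects.\<close>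
  also have "\<dots> = (\<Sum>i<d*n. (\<lambda>j k. cnj (s j * (P j $$ (k,a) - cc * \<delta> k a)) * (s j * (P j $$ (k,b) - cc * \<delta> k b))) (i div n) (i mod n))"
    using ab X by (intro sum.cong refl) (simp add: X_def)
  also have "\<dots> = (\<Sum>j<d. \<Sum>k<n. cnj (s j * (P j $$ (k,a) - cc * \<delta> k a)) * (s j * (P j $$ (k,b) - cc * \<delta> k b)))"
    by (rule sum_div_mod)
  also have "\<dots> = (\<Sum>j<d. (1 - 2 * cc) * (w j * P j $$ (a,b)) + cc * \<delta> a b * (cc * w j))"
  proof (rule sum.cong[OF refl])
    fix j assume "j \<in> {..<d}"
    then have j: "j < d" by simp
    have "(\<Sum>k<n. cnj (s j * (P j $$ (k,a) - cc * \<delta> k a)) * (s j * (P j $$ (k,b) - cc * \<delta> k b)))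
      = (\<Sum>k<n. w j * (P j $$ (a,k) * P j $$ (k,b)) - cc * w j * (\<delta> k b * P j $$ (a,k))
         - cc * w j * (\<delta> k a * P j $$ (k,b)) + cc * cc * w j * (\<delta> k a * \<delta> k b))"
    proof (rule sum.cong[OF refl])
      fix k assume "k \<in> {..<n}"
      moreover have "cnj (\<delta> k a) = \<delta> k a" by (simp add: \<delta>_def)
      ultimately show "cnj (s j * (P j $$ (k,a) - cc * \<delta> k a)) * (s j * (P j $$ (k,b) - cc * \<delta> k b))
        = w j * (P j $$ (a,k) * P j $$ (k,b)) - cc * w j * (\<delta> k b * P j $$ (a,k))
         - cc * w j * (\<delta> k a * P j $$ (k,b)) + cc * cc * w j * (\<delta> k a * \<delta> k b)"
        using j ab by (simp add: cnj_P w_conv(1) algebra_simps del: of_real_power)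
    qed
    also have "\<dots> = w j * P j $$ (a,b) - cc * w j * P j $$ (a,b) - cc * w j * P j $$ (a,b) + cc * cc * w j * \<delta> a b"
      by (simp add: sum.distrib sum_subtractf sum_distrib_left[symmetric] P_square j ab delta del: of_real_power)
    finally show "(\<Sum>k<n. cnj (s j * (P j $$ (k,a) - cc * \<delta> k a)) * (s j * (P j $$ (k,b) - cc * \<delta> k b)))
      = (1 - 2 * cc) * (w j * P j $$ (a,b)) + cc * \<delta> a b * (cc * w j)"
      by (simp add: algebra_simps del: of_real_power)
  qed
  also have "\<dots> = (1 - 2 * cc) * \<delta> a b + cc * \<delta> a b * (cc * (\<Sum>j<d. w j))"
    by (simp add: sum.distrib sum_distrib_left[symmetric] sum_w_P ab del: of_real_power)
  also have "\<dots> = (of_real (1 - c\<^sup>2) \<cdot>\<^sub>m 1\<^sub>m n) $$ (a,b)"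
    unfolding sum_w using ab by (simp add: \<delta>_def algebra_simps)
  finally show "(adj X * X) $$ (a,b) = (of_real (1 - c\<^sup>2) \<cdot>\<^sub>m 1\<^sub>m n) $$ (a,b)" .
qed (simp_all add: X_def)

section \<open>The rotation dilation attains the bound\<close>

lemma X_carrier: "X \<in> carrier_mat (d*n) n"
  by (simp add: X_def)

text \<open>The first block column of the rotation is \<open>c\<close> times the identity on top of
  the blocks of \<open>X\<close>, and by \<open>choi_identity\<close> these are Kraus operators of
  the channel. The ancilla has dimension \<open>d + 1\<close>.\<close>

lemma rotation_implements: "implements (Suc d) n (rotation_dilation n (d*n) c X) (kraus_channel n d K)"
  unfolding implements_def
proof (intro allI impI)
  fix R assume "density n R"
  then have R: "R \<in> carrier_mat n n" by (simp add: density_def psd_def)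
  let ?U = "rotation_dilation n (d*n) c X"
  have U: "?U \<in> carrier_mat (Suc d * n) (Suc d * n)"
    using rotation_dilation_unitary[OF X_carrier c_nonneg X_isometry] by (simp add: unitary_mat_def)
  have U0: "?U $$ (k,a) = of_real c * \<delta> k a" if "k < n" "a < n" for k a
    using that X_carrier by (simp add: rotation_dilation_def \<delta>_def)
  \<comment> \<open>Block 0 is taken by the multiple of the identity, so block \<open>j\<close> of
    \<open>X\<close> appears as block \<open>Suc j\<close>.\<close>
  have US: "?U $$ (Suc j * n + k, a) = s j * (P j $$ (k,a) - cc * \<delta> k a)" if "j < d" "k < n" "a < n" for j k a
  proof -
    have "j * n + k < Suc j * n" using that by simp
    also have "\<dots> \<le> d * n" using that by (intro mult_le_mono1) simp
    finally have lt: "j * n + k < d * n" .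
    then have "?U $$ (Suc j * n + k, a) = X $$ (j * n + k, a)"
      using that X_carrier by (simp add: rotation_dilation_def)
    then show ?thesis using lt that by (simp add: X_def)
  qed
  show "kraus_channel n d K R = ptrace_B (Suc d) n (?U * kron (Suc d) n (ket0bra0 (Suc d)) R * adj ?U)"
  proof (rule eq_matI)
    fix k l
    assume "k < dim_row (ptrace_B (Suc d) n (?U * kron (Suc d) n (ket0bra0 (Suc d)) R * adj ?U))"
      "l < dim_col (ptrace_B (Suc d) n (?U * kron (Suc d) n (ket0bra0 (Suc d)) R * adj ?U))"
    then have kl: "k < n" "l < n" by (auto simp: ptrace_B_def)
    have swap: "(\<Sum>j<e. \<Sum>a<n. \<Sum>b<n. f j a * R $$ (a,b) * g j b) = (\<Sum>a<n. \<Sum>b<n. R $$ (a,b) * (\<Sum>j<e. f j a * g j b))"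
      for e :: nat and f g
    proof -
      have "(\<Sum>j<e. \<Sum>a<n. \<Sum>b<n. f j a * R $$ (a,b) * g j b) = (\<Sum>a<n. \<Sum>j<e. \<Sum>b<n. f j a * R $$ (a,b) * g j b)"
        by (rule sum.swap)
      also have "\<dots> = (\<Sum>a<n. \<Sum>b<n. \<Sum>j<e. f j a * R $$ (a,b) * g j b)"
        by (intro sum.cong refl sum.swap)
      finally show ?thesis by (simp add: sum_distrib_left mult_ac)
    qed
    have "ptrace_B (Suc d) n (?U * kron (Suc d) n (ket0bra0 (Suc d)) R * adj ?U) $$ (k,l)
      = (\<Sum>j<Suc d. \<Sum>a<n. \<Sum>b<n. ?U $$ (j*n+k, a) * R $$ (a,b) * cnj (?U $$ (j*n+l, b)))"
      by (rule ptrace_dilation_entry[OF U _ R kl]) simp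
    also have "\<dots> = (\<Sum>a<n. \<Sum>b<n. R $$ (a,b) * (\<Sum>j<Suc d. ?U $$ (j*n+k, a) * cnj (?U $$ (j*n+l, b))))"
      by (rule swap)
    also have "\<dots> = (\<Sum>a<n. \<Sum>b<n. R $$ (a,b) * (\<Sum>j<d. K j $$ (k,a) * cnj (K j $$ (l,b))))"
    proof (rule sum.cong[OF refl], rule sum.cong[OF refl])
      fix a b assume "a \<in> {..<n}" "b \<in> {..<n}"
      then have ab: "a < n" "b < n" by auto
      have "(\<Sum>j<Suc d. ?U $$ (j*n+k, a) * cnj (?U $$ (j*n+l, b)))
        = ?U $$ (k,a) * cnj (?U $$ (l,b)) + (\<Sum>j<d. ?U $$ (Suc j*n+k, a) * cnj (?U $$ (Suc j*n+l, b)))"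
        unfolding sum.lessThan_Suc_shift by simp
      also have "?U $$ (k,a) * cnj (?U $$ (l,b)) = cc * \<delta> k a * \<delta> l b"
        using ab kl by (simp add: U0) (simp add: \<delta>_def power2_eq_square)
      also have "(\<Sum>j<d. ?U $$ (Suc j*n+k, a) * cnj (?U $$ (Suc j*n+l, b)))
        = (\<Sum>j<d. s j * (P j $$ (k,a) - cc * \<delta> k a) * cnj (s j * (P j $$ (l,b) - cc * \<delta> l b)))"
        using ab kl by (intro sum.cong refl) (simp only: US lessThan_iff)
      finally show "R $$ (a,b) * (\<Sum>j<Suc d. ?U $$ (j*n+k, a) * cnj (?U $$ (j*n+l, b)))
        = R $$ (a,b) * (\<Sum>j<d. K j $$ (k,a) * cnj (K j $$ (l,b)))"
        unfolding choi_identity[OF kl(1) ab(1) kl(2) ab(2)] by simp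
    qed
    also have "\<dots> = kraus_channel n d K R $$ (k,l)"
      unfolding swap[symmetric] by (rule kraus_channel_entry[where K = K and d = d, OF K_carrier R kl, symmetric])
    finally show "kraus_channel n d K R $$ (k,l)
      = ptrace_B (Suc d) n (?U * kron (Suc d) n (ket0bra0 (Suc d)) R * adj ?U) $$ (k,l)" by simp
  qed (simp_all add: kraus_channel_def mat_sum_def ptrace_B_def)
qed

text \<open>The infimum is a minimum, attained by the rotation with ancilla dimension
  \<open>Suc d\<close>.\<close>

lemma channel_cost_eq: "channel_cost n (kraus_channel n d K) = arccos c"
  unfolding channel_cost_def
proof (rule cInf_eq_minimum)
  let ?U = "rotation_dilation n (d*n) c X"
  have U: "unitary_mat (Suc d * n) ?U"
    using rotation_dilation_unitary[OF X_carrier c_nonneg X_isometry] by simp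
  \<comment> \<open>The estimate for the rotation gives one inequality, the lower bound for any
    implementation the other.\<close>
  have "unitary_cost ?U = arccos c"
    using rotation_dilation_cost[OF X_carrier c_nonneg X_isometry c_le_one n]
      arccos_le_unitary_cost[OF U _ rotation_implements] by simp
  then show "arccos c \<in> {unitary_cost U | U m. 0 < m \<and> unitary_mat (m*n) U \<and> implements m n U (kraus_channel n d K)}"
    using U rotation_implements by (metis (mono_tags, lifting) mem_Collect_eq zero_less_Suc)
qed (use arccos_le_unitary_cost in blast)

end

theorem theorem4:
  fixes n d r :: nat and s :: "nat \<Rightarrow> complex" and P K :: "nat \<Rightarrow> complex mat"
  assumes "0 < n"
    and "\<And>j. j < d \<Longrightarrow> P j \<in> carrier_mat n n"
    and "\<And>j. j < d \<Longrightarrow> P j * P j = P j"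
    and "\<And>j. j < d \<Longrightarrow> adj (P j) = P j"
    and "\<And>j. j < d \<Longrightarrow> vec_space.rank n (P j) = r"
    and "\<And>j. j < d \<Longrightarrow> K j = s j \<cdot>\<^sub>m P j"
    and "mat_sum n d (\<lambda>j. adj (K j) * K j) = 1\<^sub>m n"
  shows "channel_cost n (kraus_channel n d K) = arccos (sqrt (real r / real n))"
proof -
  interpret scaled_projectors n d r s P K
    using assms by unfold_locales
  show ?thesis using channel_cost_eq by (simp only: c_def)
qed

end
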